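(* Let $\mathcal{A}$ be a commutative $\mathbb{C}$-algebra without zero divisors, equipped with a derivation $\partial$ such that $\ker\partial=\mathbb{C}$ (identified with $\mathbb{C}\cdot 1_{\mathcal A}$). Let $\mathcal{C}_0\subset\mathcal{A}$ be a differential subring ($\partial(\mathcal{C}_0)\subset\mathcal{C}_0$) which is an integral domain containing $\mathbb{C}$. Let $\mathcal{X}$ be an alphabet, let $(u_x)_{x\in\mathcal{X}}$ be a family of elements of $\mathcal{C}_0$, put $M=\sum_{x\in\mathcal{X}}u_x x\in\mathcal{C}_0\langle\!\langle\mathcal{X}\rangle\!\rangle$, and consider the differential equation $$\mathbf{d}S=MS,\qquad \langle S\mid 1_{\mathcal{X}^*}\rangle=1_{\mathcal A}.\qquad (E)$$ Let $S\in\mathcal{A}\langle\!\langle\mathcal{X}\rangle\!\rangle$ be a grouplike solution of $(E)$, in the form $$S=1_{\mathcal{X}^*}+\sum_{w\in\mathcal{X}^*\mathcal{X}}\langle S\mid w\rangle w=1_{\mathcal{X}^*}+\sum_{w\in\mathcal{X}^*\mathcal{X}}\langle S\mid S_w\rangle P_w=\prod^{\searrow}_{l\in\mathcal{L}yn\,\mathcal{X}}e^{\langle S\mid S_l\rangle P_l}.$$ Then: (i) If $H\in\mathcal{A}\langle\!\langle\mathcal{X}\rangle\!\rangle$ is another grouplike solution of $(E)$, then there exists $C\in\mathcal{L}ie_{\mathcal{A}}\langle\!\langle\mathcal{X}\rangle\!\rangle$ such that $S=He^{C}$ (and conversely). (ii) The following assertions are equivalent: (a) the family $\{\langle S\mid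 w\rangle\}_{w\in\mathcal{X}^*}$ is $\mathcal{C}_0$-linearly independent; (b) the family $\{\langle S\mid l\rangle\}_{l\in\mathcal{L}yn\,\mathcal{X}}$ is $\mathcal{C}_0$-algebraically independent; (c) the family $\{\langle S\mid x\rangle\}_{x\in\mathcal{X}}$ is $\mathcal{C}_0$-algebraically independent; (d) the family $\{\langle S\mid x\rangle\}_{x\in\mathcal{X}\cup\{1_{\mathcal{X}^*}\}}$ is $\mathcal{C}_0$-linearly independent; (e) the family $\{u_x\}_{x\in\mathcal{X}}$ is such that, for every $f\in\mathrm{Frac}(\mathcal{C}_0)$ and every finitely supported family $(c_x)_{x\in\mathcal{X}}\in\mathbb{C}^{(\mathcal{X})}$, $$\sum_{x\in\mathcal{X}}c_xu_x=\partial f\ \Longrightarrow\ (\forall x\in\mathcal{X})(c_x=0);$$ (f) the family $(u_x)_{x\in\mathcal{X}}$ is free over $\mathbb{C}$ and $\partial\,\mathrm{Frac}(\mathcal{C}_0)\cap\mathrm{span}_{\mathbb{C}}\{u_x\}_{x\in\mathcal{X}}=\{0\}$.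
   Context: $\mathcal{X}$ is a totally ordered alphabet (finite such as $X=\{x_0,\dots,x_m\}$, or infinite such as $Y=\{y_k\}_{k\ge1}$), $\mathcal{X}^*$ is the free monoid on $\mathcal{X}$ with neutral element (empty word) $1_{\mathcal{X}^*}$, and $\mathcal{X}^*\mathcal{X}$ is the set of nonempty words. For a commutative ring $A$, $A\langle\mathcal{X}\rangle$ (resp. $A\langle\!\langle\mathcal{X}\rangle\!\rangle$) is the algebra of noncommutative polynomials (resp. series) with the concatenation product. $\langle S\mid w\rangle$ is the coefficient of $w$ in $S$, extended to polynomials by $\langle S\mid P\rangle=\sum_w\langle S\mid w\rangle\langle P\mid w\rangle$. The derivation $\mathbf d$ on $\mathcal{A}\langle\!\langle\mathcal{X}\rangle\!\rangle$ is $\mathbf{d}S=\sum_{w\in\mathcal{X}^*}(\partial\langle S\mid w\rangle)w$. The derivation $\partial$ extends uniquely to the fraction field $\mathrm{Frac}(\mathcal{A})\supset\mathrm{Frac}(\mathcal{C}_0)$ and is still denoted $\partial$. The shuffle product $\sqcup\!\sqcup$ is the bilinear product with $w\sqcup\!\sqcup 1_{\mathcal{X}^*}=1_{\mathcal{X}^*}\sqcup\!\sqcup w=w$ and $xu\sqcup\!\sqcup yv=x(u\sqcup\!\sqcup yv)+y(xu\sqcup\!\sqcup v)$ for letters $x,y$ and words $u,v,w$. A series $S$ is grouplike if $\langle S\mid 1_{\mathcal{X}^*}\rangle=1$ and $\langle S\mid u\sqcup\!\sqcup v\rangle=\langle S\mid u\rangle\langle S\mid v\rangle$ for all $u,v\in\mathcal{X}^*$.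 $\mathcal{L}ie_{\mathcal{A}}\langle\!\langle\mathcal{X}\rangle\!\rangle$ is the set of Lie series over $\mathcal{A}$, i.e. the series in $\mathcal{A}\langle\!\langle\mathcal{X}\rangle\!\rangle$ with zero constant term whose multihomogeneous components are all Lie polynomials with coefficients in $\mathcal{A}$ (elements of the free Lie algebra over $\mathcal{A}$ inside $\mathcal{A}\langle\mathcal{X}\rangle$). $\mathcal{L}yn\,\mathcal{X}$ is the set of Lyndon words over $\mathcal{X}$. For a Lyndon word $l$ of length $\ge 2$, its standard factorization $st(l)=(l_1,l_2)$ is $l=l_1l_2$ with $l_2$ the longest proper right factor of $l$ that is a Lyndon word. The dual bases $\{P_w\}$, $\{S_w\}$ are given by: $P_x=S_x=x$ for $x\in\mathcal{X}$; $P_l=[P_{l_1},P_{l_2}]$ and $S_l=yS_{l'}$ for $l=yl'\in\mathcal{L}yn\,\mathcal{X}\setminus\mathcal{X}$ with $y\in\mathcal X$, $st(l)=(l_1,l_2)$; and, for $w=l_1^{i_1}\cdots l_k^{i_k}$ with $l_1>\dots>l_k$ Lyndon words, $P_w=P_{l_1}^{i_1}\cdots P_{l_k}^{i_k}$ and $S_w=\frac{1}{i_1!\cdots i_k!}S_{l_1}^{\sqcup\!\sqcup i_1}\sqcup\!\sqcup\cdots\sqcup\!\sqcup S_{l_k}^{\sqcup\!\sqcup i_k}$. The product $\prod^{\searrow}$ is taken over Lyndon words in decreasing lexicographic order.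
   Formalization: In (ii) the full equivalence also assumes that every ∂-constant p/q with p in A, q in C_0 nonzero, lies in C (without it only a⇔b⇒c⇒d and e⇔f are claimed); the converse in (i) reads: if S=He^C with C a Lie series, then H is grouplike, and H solves (E) iff dC=0. *)

theory Defs
  imports
    Complex_Main
    "HOL-Computational_Algebra.Polynomial_Factorial"
    "HOL-Library.List_Lexorder"
    "HOL-Library.Multiset"
    "HOL-Library.Poly_Mapping"
begin

section \<open>Complex algebras, derivations and the fraction field\<close>

text \<open>The structure of a unital \<open>\<complex>\<close>-algebra on a commutative ring is given by its structure
  homomorphism \<open>\<iota>\<close>; the copy of \<open>\<complex>\<close> inside the ring is \<open>range \<iota>\<close>.\<close>

definition complex_algebra :: "(complex \<Rightarrow> 'a::comm_ring_1) \<Rightarrow> bool" where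
  "complex_algebra \<iota> \<longleftrightarrow>
     \<iota> 1 = 1 \<and> (\<forall>x y. \<iota> (x + y) = \<iota> x + \<iota> y) \<and> (\<forall>x y. \<iota> (x * y) = \<iota> x * \<iota> y)"

definition derivation :: "('a::comm_ring_1 \<Rightarrow> 'a) \<Rightarrow> bool" where
  "derivation \<delta> \<longleftrightarrow>
     (\<forall>x y. \<delta> (x + y) = \<delta> x + \<delta> y) \<and> (\<forall>x y. \<delta> (x * y) = \<delta> x * y + x * \<delta> y)"

definition differential_subring :: "('a::comm_ring_1 \<Rightarrow> 'a) \<Rightarrow> 'a set \<Rightarrow> bool" where
  "differential_subring \<delta> C \<longleftrightarrow>
     0 \<in> C \<and> 1 \<in> C \<and> (\<forall>x\<in>C. - x \<in> C) \<and> (\<forall>x\<in>C. \<forall>y\<in>C. x + y \<in> C) \<and>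
     (\<forall>x\<in>C. \<forall>y\<in>C. x * y \<in> C) \<and> \<delta> ` C \<subseteq> C"

definition Frac :: "'a::idom set \<Rightarrow> 'a fract set" where
  "Frac C = {Fract a b |a b. a \<in> C \<and> b \<in> C \<and> b \<noteq> 0}"

text \<open>The unique extension of a derivation to the fraction field; see \<open>ex1_fract_deriv\<close>
  and \<open>fract_deriv_Fract\<close> below.\<close>

definition fract_deriv :: "('a::idom \<Rightarrow> 'a) \<Rightarrow> 'a fract \<Rightarrow> 'a fract" where
  "fract_deriv \<delta> = (THE D. derivation D \<and> (\<forall>a. D (to_fract a) = to_fract (\<delta> a)))"

lemma derivation_quotient:
  fixes D :: "'a::idom fract \<Rightarrow> 'a fract"
  assumes D: "derivation D" and ext: "\<And>a. D (to_fract a) = to_fract (\<delta> a)" and b: "b \<noteq> 0"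
  shows "D (Fract a b) = Fract (\<delta> a * b - a * \<delta> b) (b * b)"
proof -
  have eq: "to_fract a = Fract a b * to_fract b"
    using b by (simp add: to_fract_def eq_fract)
  have "to_fract (\<delta> a) = D (Fract a b * to_fract b)"
    using ext eq by metis
  also have "\<dots> = D (Fract a b) * to_fract b + Fract a b * to_fract (\<delta> b)"
    using D ext by (simp add: derivation_def)
  finally have h: "D (Fract a b) * to_fract b = to_fract (\<delta> a) - Fract a b * to_fract (\<delta> b)"
    by simp
  also have "\<dots> = Fract (\<delta> a * b - a * \<delta> b) (b * b) * to_fract b"
    using b by (simp add: to_fract_def eq_fract algebra_simps)
  finally show ?thesis using b by simp
qed

lemma ex1_fract_deriv:
  fixes \<delta> :: "'a::idom \<Rightarrow> 'a"
  assumes d: "derivation \<delta>"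
  shows "\<exists>!D. derivation D \<and> (\<forall>a. D (to_fract a) = to_fract (\<delta> a))"
proof (rule ex_ex1I)
  have add: "\<delta> (x + y) = \<delta> x + \<delta> y" and mult: "\<delta> (x * y) = \<delta> x * y + x * \<delta> y" for x y
    using d by (auto simp: derivation_def)
  have "\<delta> 1 = \<delta> 1 + \<delta> 1"
    using mult[of 1 1] by (simp only: mult_1_left mult_1_right)
  then have one: "\<delta> 1 = 0" by (metis add_cancel_right_right)
  define D where "D q = (SOME r. \<exists>a b. b \<noteq> 0 \<and> q = Fract a b \<and>
    r = Fract (\<delta> a * b - a * \<delta> b) (b * b))" for q :: "'a fract"
  have D: "D (Fract a b) = Fract (\<delta> a * b - a * \<delta> b) (b * b)" if b: "b \<noteq> 0" for a b
  proof -
    have "\<exists>a' b'. b' \<noteq> 0 \<and> Fract a b = Fract a' b' \<and>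
        D (Fract a b) = Fract (\<delta> a' * b' - a' * \<delta> b') (b' * b')"
      unfolding D_def by (rule someI_ex) (use b in blast)
    then obtain a' b' where b': "b' \<noteq> 0" and eq: "Fract a b = Fract a' b'"
      and De: "D (Fract a b) = Fract (\<delta> a' * b' - a' * \<delta> b') (b' * b')" by blast
    have e: "a * b' = a' * b" using eq b b' by (simp add: eq_fract)
    have de: "\<delta> a * b' + a * \<delta> b' = \<delta> a' * b + a' * \<delta> b"
      using arg_cong[OF e, of \<delta>] by (simp add: mult)
    have "(\<delta> a' * b' - a' * \<delta> b') * (b * b) =
      b * b' * (\<delta> a' * b + a' * \<delta> b) - b' * \<delta> b * (a' * b) - b * \<delta> b' * (a' * b)"
      by (simp add: algebra_simps)
    also have "\<dots> =
      b * b' * (\<delta> a * b' + a * \<delta> b') - b' * \<delta> b * (a * b') - b * \<delta> b' * (a * b')"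
      by (simp only: e de)
    also have "\<dots> = (\<delta> a * b - a * \<delta> b) * (b' * b')"
      by (simp add: algebra_simps)
    finally show ?thesis using b b' De by (simp add: eq_fract)
  qed
  have "derivation D"
    unfolding derivation_def
  proof (intro conjI allI)
    fix x y :: "'a fract"
    obtain a b where x: "x = Fract a b" "b \<noteq> 0" by (cases x) auto
    obtain c e where y: "y = Fract c e" "e \<noteq> 0" by (cases y) auto
    show "D (x + y) = D x + D y"
      using x y by (simp add: D eq_fract add mult) (simp add: algebra_simps)
    show "D (x * y) = D x * y + x * D y"
      using x y by (simp add: D eq_fract add mult) (simp add: algebra_simps)
  qed
  moreover have "D (to_fract a) = to_fract (\<delta> a)" for a
    by (simp add: to_fract_def D one)
  ultimately show "\<exists>D. derivation D \<and> (\<forall>a. D (to_fract a) = to_fract (\<delta> a))" by blast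
next
  fix D E :: "'a fract \<Rightarrow> 'a fract"
  assume D: "derivation D \<and> (\<forall>a. D (to_fract a) = to_fract (\<delta> a))"
    and E: "derivation E \<and> (\<forall>a. E (to_fract a) = to_fract (\<delta> a))"
  show "D = E"
  proof
    fix q :: "'a fract"
    obtain a b where q: "q = Fract a b" "b \<noteq> 0" by (cases q) auto
    show "D q = E q"
      using derivation_quotient[of D \<delta> b a] derivation_quotient[of E \<delta> b a] D E q by simp
  qed
qed

lemma fract_deriv:
  assumes "derivation \<delta>"
  shows "derivation (fract_deriv \<delta>)" "fract_deriv \<delta> (to_fract a) = to_fract (\<delta> a)"
  using theI'[OF ex1_fract_deriv[OF assms]] by (auto simp: fract_deriv_def)

lemma fract_deriv_Fract:
  assumes "derivation \<delta>" "b \<noteq> 0"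
  shows "fract_deriv \<delta> (Fract a b) = Fract (\<delta> a * b - a * \<delta> b) (b * b)"
  by (rule derivation_quotient) (use assms fract_deriv[OF assms(1)] in auto)

text \<open>The ring of fractions \<open>p / q\<close> with \<open>p\<close> in the whole ring and \<open>q \<in> C\<close> contains both the ring
  itself and \<open>Frac C\<close>, and can have constants outside \<open>\<complex>\<close> even if \<open>ker \<delta> = \<complex>\<close> in the ring: for
  \<open>\<complex>[p, q, s]\<close> with \<open>\<delta> p = p\<close>, \<open>\<delta> q = p + q\<close>, \<open>\<delta> s = 1\<close> and \<open>C = \<complex>[p, q]\<close> one has
  \<open>ker \<delta> = \<complex>\<close> but \<open>\<delta> (q / p - s) = 0\<close>. The following condition says that there are no such constants. If
  \<open>C\<close> is a field, or if \<open>ker \<delta> = \<complex>\<close> holds in the full fraction field, it is automatic.\<close>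

definition no_new_constants :: "(complex \<Rightarrow> 'a::idom) \<Rightarrow> ('a \<Rightarrow> 'a) \<Rightarrow> 'a set \<Rightarrow> bool" where
  "no_new_constants \<iota> \<delta> C \<longleftrightarrow>
     (\<forall>p. \<forall>q\<in>C. q \<noteq> 0 \<and> fract_deriv \<delta> (Fract p q) = 0 \<longrightarrow> (\<exists>z. Fract p q = to_fract (\<iota> z)))"


section \<open>Linear and algebraic independence of families over a subring\<close>

definition lin_indep :: "'a::comm_ring_1 set \<Rightarrow> 'i set \<Rightarrow> ('i \<Rightarrow> 'a) \<Rightarrow> bool" where
  "lin_indep C I a \<longleftrightarrow>
     (\<forall>c :: 'i \<Rightarrow>\<^sub>0 'a. Poly_Mapping.keys c \<subseteq> I \<and> (\<forall>i. Poly_Mapping.lookup c i \<in> C) \<and>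
        (\<Sum>i\<in>Poly_Mapping.keys c. Poly_Mapping.lookup c i * a i) = 0 \<longrightarrow> c = 0)"

text \<open>A polynomial in commuting indeterminates indexed by \<open>'i\<close> is a finitely supported map from
  monomials (finitely supported exponent functions) to coefficients.\<close>

definition mpoly_eval :: "('i \<Rightarrow> 'a::comm_ring_1) \<Rightarrow> (('i \<Rightarrow>\<^sub>0 nat) \<Rightarrow>\<^sub>0 'a) \<Rightarrow> 'a" where
  "mpoly_eval a p = (\<Sum>m\<in>Poly_Mapping.keys p. Poly_Mapping.lookup p m * (\<Prod>i\<in>Poly_Mapping.keys m. a i ^ Poly_Mapping.lookup m i))"

definition alg_indep :: "'a::comm_ring_1 set \<Rightarrow> 'i set \<Rightarrow> ('i \<Rightarrow> 'a) \<Rightarrow> bool" where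
  "alg_indep C I a \<longleftrightarrow>
     (\<forall>p :: ('i \<Rightarrow>\<^sub>0 nat) \<Rightarrow>\<^sub>0 'a. (\<forall>m\<in>Poly_Mapping.keys p. Poly_Mapping.keys m \<subseteq> I) \<and> (\<forall>m. Poly_Mapping.lookup p m \<in> C) \<and>
        mpoly_eval a p = 0 \<longrightarrow> p = 0)"


section \<open>Noncommutative series\<close>

text \<open>Words over the alphabet \<open>'x\<close> are lists, a series is its coefficient function, so that
  \<open>\<langle>S | w\<rangle>\<close> is \<open>S w\<close>; polynomials are the series of finite support.\<close>

type_synonym ('x, 'a) series = "'x list \<Rightarrow> 'a"

definition word :: "'x list \<Rightarrow> ('x, 'a::comm_ring_1) series" where
  "word w = (\<lambda>v. if v = w then 1 else 0)"

definition smult_series :: "'a::comm_ring_1 \<Rightarrow> ('x, 'a) series \<Rightarrow> ('x, 'a) series" where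
  "smult_series a S = (\<lambda>w. a * S w)"

definition add_series :: "('x, 'a::comm_ring_1) series \<Rightarrow> ('x, 'a) series \<Rightarrow> ('x, 'a) series" where
  "add_series S T = (\<lambda>w. S w + T w)"

definition conc :: "('x, 'a::comm_ring_1) series \<Rightarrow> ('x, 'a) series \<Rightarrow> ('x, 'a) series" where
  "conc S T = (\<lambda>w. \<Sum>i\<le>length w. S (take i w) * T (drop i w))"

definition bracket :: "('x, 'a::comm_ring_1) series \<Rightarrow> ('x, 'a) series \<Rightarrow> ('x, 'a) series" where
  "bracket S T = (\<lambda>w. conc S T w - conc T S w)"

text \<open>\<open>\<langle>S | P\<rangle>\<close> for a polynomial \<open>P\<close>.\<close>

definition pairing :: "('x, 'a::comm_ring_1) series \<Rightarrow> ('x, 'a) series \<Rightarrow> 'a" where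
  "pairing S P = (\<Sum>w | P w \<noteq> 0. S w * P w)"

text \<open>The exponential of a series \<open>C\<close> without constant term: as \<open>C\<^sup>n\<close> vanishes on words shorter
  than \<open>n\<close>, the sum over \<open>n \<le> length w\<close> is the full coefficient of \<open>w\<close>.\<close>

definition exp_series :: "(complex \<Rightarrow> 'a::comm_ring_1) \<Rightarrow> ('x, 'a) series \<Rightarrow> ('x, 'a) series" where
  "exp_series \<iota> C = (\<lambda>w. \<Sum>n\<le>length w. \<iota> (1 / fact n) * (conc C ^^ n) (word []) w)"

text \<open>Unlike the library's \<open>shuffles\<close>, which is a set of words, this is a polynomial:
  words are counted with multiplicity.\<close>

fun shuffle_word :: "'x list \<Rightarrow> 'x list \<Rightarrow> ('x, 'a::comm_ring_1) series" where
  "shuffle_word [] v = word v"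
| "shuffle_word (x # u) [] = word (x # u)"
| "shuffle_word (x # u) (y # v) =
     add_series (conc (word [x]) (shuffle_word u (y # v)))
                (conc (word [y]) (shuffle_word (x # u) v))"

text \<open>Bilinear extension to polynomials.\<close>

definition shuffle :: "('x, 'a::comm_ring_1) series \<Rightarrow> ('x, 'a) series \<Rightarrow> ('x, 'a) series" where
  "shuffle P Q = (\<lambda>w. \<Sum>u | P u \<noteq> 0. \<Sum>v | Q v \<noteq> 0. P u * Q v * shuffle_word u v w)"

definition grouplike :: "('x, 'a::comm_ring_1) series \<Rightarrow> bool" where
  "grouplike S \<longleftrightarrow> S [] = 1 \<and> (\<forall>u v. pairing S (shuffle_word u v) = S u * S v)"

definition deriv_series :: "('a \<Rightarrow> 'a) \<Rightarrow> ('x, 'a) series \<Rightarrow> ('x, 'a) series" where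
  "deriv_series \<delta> S = (\<lambda>w. \<delta> (S w))"

text \<open>The series \<open>\<Sum>\<^sub>x u\<^sub>x x\<close>.\<close>

definition letter_series :: "('x \<Rightarrow> 'a::comm_ring_1) \<Rightarrow> ('x, 'a) series" where
  "letter_series u = (\<lambda>w. case w of [x] \<Rightarrow> u x | _ \<Rightarrow> 0)"

definition solution :: "('a::comm_ring_1 \<Rightarrow> 'a) \<Rightarrow> ('x, 'a) series \<Rightarrow> ('x, 'a) series \<Rightarrow> bool" where
  "solution \<delta> M S \<longleftrightarrow> deriv_series \<delta> S = conc M S \<and> S [] = 1"

text \<open>Lie polynomials form the smallest submodule containing the letters and closed under
  brackets.\<close>

inductive_set lie_polys :: "('x, 'a::comm_ring_1) series set" where
  zero: "(\<lambda>_. 0) \<in> lie_polys"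
| letter: "word [x] \<in> lie_polys"
| add: "P \<in> lie_polys \<Longrightarrow> Q \<in> lie_polys \<Longrightarrow> add_series P Q \<in> lie_polys"
| smult: "P \<in> lie_polys \<Longrightarrow> smult_series a P \<in> lie_polys"
| bracket: "P \<in> lie_polys \<Longrightarrow> Q \<in> lie_polys \<Longrightarrow> bracket P Q \<in> lie_polys"

text \<open>A multidegree is a multiset of letters.\<close>

definition multihom_component :: "'x multiset \<Rightarrow> ('x, 'a::comm_ring_1) series \<Rightarrow> ('x, 'a) series" where
  "multihom_component \<alpha> S = (\<lambda>w. if mset w = \<alpha> then S w else 0)"

definition lie_series :: "('x, 'a::comm_ring_1) series set" where
  "lie_series = {S. S [] = 0 \<and> (\<forall>\<alpha>. multihom_component \<alpha> S \<in> lie_polys)}"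


section \<open>Lyndon words\<close>

text \<open>Words over an ordered alphabet are compared by \<open>HOL-Library.List_Lexorder\<close>, in which a
  proper prefix is smaller.\<close>

definition lyndon :: "'x::linorder list \<Rightarrow> bool" where
  "lyndon w \<longleftrightarrow> w \<noteq> [] \<and> (\<forall>u v. w = u @ v \<and> u \<noteq> [] \<and> v \<noteq> [] \<longrightarrow> w < v)"

text \<open>The least splitting position gives the longest proper right factor that is Lyndon.\<close>

definition st_pos :: "'x::linorder list \<Rightarrow> nat" where
  "st_pos l = (LEAST k. 0 < k \<and> k < length l \<and> lyndon (drop k l))"

definition st :: "'x::linorder list \<Rightarrow> 'x list \<times> 'x list" where
  "st l = (take (st_pos l) l, drop (st_pos l) l)"

definition is_lyndon_fact :: "'x::linorder list \<Rightarrow> 'x list list \<Rightarrow> bool" where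
  "is_lyndon_fact w ls \<longleftrightarrow> (\<forall>l\<in>set ls. lyndon l) \<and> sorted_wrt (\<ge>) ls \<and> concat ls = w"

text \<open>The nonincreasing factorization into Lyndon words, with repetitions; it exists uniquely by
  \<open>ex1_lyndon_fact\<close> below.\<close>

definition lyndon_fact :: "'x::linorder list \<Rightarrow> 'x list list" where
  "lyndon_fact w = (THE ls. is_lyndon_fact w ls)"

lemma lyndon_single [simp]: "lyndon [x]"
  by (auto simp: lyndon_def Cons_eq_append_conv)

lemma append_less_append_iff: "w @ u < w @ v \<longleftrightarrow> u < (v :: 'x::linorder list)"
  by (induction w) auto

lemma less_append: "v \<noteq> [] \<Longrightarrow> u < u @ (v :: 'x::linorder list)"
  by (induction u) (auto simp: neq_Nil_conv)

lemma le_append: "u \<le> u @ (v :: 'x::linorder list)"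
  by (cases "v = []") (auto intro: less_imp_le less_append)

lemma less_not_prefix_append:
  "u < v \<Longrightarrow> (\<nexists>t. v = u @ t) \<Longrightarrow> u @ a < v @ (b :: 'x::linorder list)"
proof (induction u arbitrary: v)
  case Nil
  then show ?case by auto
next
  case (Cons x u)
  then show ?case by (cases v) auto
qed

lemma lyndon_append:
  assumes u: "lyndon u" and v: "lyndon v" and uv: "u < v"
  shows "lyndon (u @ v)"
proof -
  have ne: "u \<noteq> []" "v \<noteq> []" using u v by (auto simp: lyndon_def)
  have less: "u @ v < v"
  proof (cases "\<exists>t. v = u @ t")
    case True
    then obtain t where t: "v = u @ t" by blast
    have "t \<noteq> []" using t uv by auto
    then have "v < t" using v t ne by (auto simp: lyndon_def)
    then have "u @ v < u @ t" by (simp only: append_less_append_iff)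
    then show ?thesis using t by simp
  next
    case False
    from less_not_prefix_append[OF uv this, of v "[]"] show ?thesis by simp
  qed
  have "u @ v < s" if eq: "u @ v = p @ s" and p: "p \<noteq> []" and s: "s \<noteq> []" for p s
  proof -
    from eq consider t where "p = u @ t" "v = t @ s" | t where "u = p @ t" "s = t @ v" "t \<noteq> []"
      by (auto simp: append_eq_append_conv2) (metis append_Nil append_Nil2)+
    then show ?thesis
    proof cases
      case 1
      then have "v \<le> s" using v s by (cases "t = []") (auto simp: lyndon_def intro: less_imp_le)
      with less show ?thesis by simp
    next
      case 2
      then have "u < t" using u p by (auto simp: lyndon_def)
      moreover have "\<nexists>r. t = u @ r" using 2 p by (auto dest: arg_cong[where f = length])
      ultimately show ?thesis using less_not_prefix_append 2 by blast
    qed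
  qed
  then show ?thesis using ne by (auto simp: lyndon_def)
qed

lemma lyndon_fact_insert:
  "lyndon l \<Longrightarrow> is_lyndon_fact w ls \<Longrightarrow> \<exists>ms. is_lyndon_fact (l @ w) ms"
proof (induction ls arbitrary: l w)
  case Nil
  then show ?case by (intro exI[of _ "[l]"]) (auto simp: is_lyndon_fact_def)
next
  case (Cons m ls)
  show ?case
  proof (cases "m \<le> l")
    case True
    then have "is_lyndon_fact (l @ w) (l # m # ls)"
      using Cons.prems by (auto simp: is_lyndon_fact_def)
    then show ?thesis by blast
  next
    case False
    then have "lyndon (l @ m)"
      using Cons.prems by (intro lyndon_append) (auto simp: is_lyndon_fact_def)
    moreover have "is_lyndon_fact (concat ls) ls"
      using Cons.prems by (auto simp: is_lyndon_fact_def)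
    ultimately have "\<exists>ms. is_lyndon_fact ((l @ m) @ concat ls) ms" by (rule Cons.IH)
    then show ?thesis using Cons.prems by (auto simp: is_lyndon_fact_def)
  qed
qed

lemma lyndon_fact_exists: "\<exists>ls. is_lyndon_fact w ls"
proof (induction w)
  case Nil
  show ?case by (intro exI[of _ "[]"]) (auto simp: is_lyndon_fact_def)
next
  case (Cons x w)
  then show ?case using lyndon_fact_insert[of "[x]" w] by auto
qed

lemma prefix_concat_end:
  "t \<noteq> [] \<Longrightarrow> t @ r = concat ms \<Longrightarrow>
     \<exists>q p m s. t = q @ p \<and> p \<noteq> [] \<and> m \<in> set ms \<and> m = p @ s"
proof (induction ms arbitrary: t)
  case Nil
  then show ?case by simp
next
  case (Cons m ms)
  from Cons.prems(2) consider s where "m = t @ s"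
    | t' where "t = m @ t'" "t' @ r = concat ms" "t' \<noteq> []"
    by (auto simp: append_eq_append_conv2) (metis append_Nil2)+
  then show ?case
  proof cases
    case 1
    then show ?thesis using Cons.prems(1)
      by (intro exI[of _ "[]"] exI[of _ t] exI[of _ m] exI[of _ s]) auto
  next
    case 2
    from Cons.IH[OF 2(3) 2(2)] obtain q p n s
      where "t' = q @ p" "p \<noteq> []" "n \<in> set ms" "n = p @ s" by blast
    then show ?thesis using 2(1)
      by (intro exI[of _ "m @ q"] exI[of _ p] exI[of _ n] exI[of _ s]) auto
  qed
qed

lemma lyndon_fact_head:
  assumes "is_lyndon_fact w (l # ls)" "is_lyndon_fact w (m # ms)"
  shows "length l \<le> length m"
proof (rule ccontr)
  assume "\<not> ?thesis"
  then have len: "length m < length l" by simp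
  have eq: "l @ concat ls = m @ concat ms" using assms by (simp add: is_lyndon_fact_def)
  then obtain t where t: "l = m @ t" "t @ concat ls = concat ms"
    using len by (auto simp: append_eq_append_conv2)
  have "t \<noteq> []" using t len by auto
  from prefix_concat_end[OF this t(2)] obtain q p n s
    where p: "t = q @ p" "p \<noteq> []" "n \<in> set ms" "n = p @ s" by blast
  have "m \<noteq> []" using assms(2) by (auto simp: is_lyndon_fact_def lyndon_def)
  then have "l < p"
    using assms(1) t p unfolding is_lyndon_fact_def lyndon_def
    by (metis append.assoc append_is_Nil_conv list.set_intros(1))
  also have "p \<le> n" using p le_append by blast
  also have "n \<le> m" using assms(2) p by (auto simp: is_lyndon_fact_def)
  also have "m \<le> l" using t le_append by blast
  finally show False by simp
qed

lemma lyndon_fact_unique: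
  "is_lyndon_fact w ls \<Longrightarrow> is_lyndon_fact w ms \<Longrightarrow> ls = ms"
proof (induction ls arbitrary: w ms)
  case Nil
  then show ?case by (cases ms) (auto simp: is_lyndon_fact_def lyndon_def)
next
  case (Cons l ls)
  show ?case
  proof (cases ms)
    case Nil
    then show ?thesis using Cons.prems by (auto simp: is_lyndon_fact_def lyndon_def)
  next
    case (Cons m ms')
    have "length l = length m"
      using lyndon_fact_head Cons.prems Cons by (metis le_antisym)
    moreover have "l @ concat ls = m @ concat ms'"
      using Cons.prems Cons by (simp add: is_lyndon_fact_def)
    ultimately have "l = m" "concat ls = concat ms'" by auto
    moreover have "is_lyndon_fact (concat ls) ls" "is_lyndon_fact (concat ms') ms'"
      using Cons.prems Cons by (auto simp: is_lyndon_fact_def)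
    ultimately show ?thesis using Cons.IH Cons by metis
  qed
qed

lemma ex1_lyndon_fact: "\<exists>!ls. is_lyndon_fact w ls"
  using lyndon_fact_exists lyndon_fact_unique by blast

lemma is_lyndon_fact_lyndon_fact: "is_lyndon_fact w (lyndon_fact w)"
  unfolding lyndon_fact_def by (rule theI'[OF ex1_lyndon_fact])

lemma lyndon_fact_shorter:
  assumes "\<not> lyndon w" "l \<in> set (lyndon_fact w)"
  shows "length l < length w"
proof -
  let ?ls = "lyndon_fact w"
  have f: "is_lyndon_fact w ?ls" by (rule is_lyndon_fact_lyndon_fact)
  obtain as bs where s: "?ls = as @ l # bs" using assms(2) by (meson split_list)
  have w: "w = concat as @ l @ concat bs" using f s by (auto simp: is_lyndon_fact_def)
  have "lyndon l" using f assms(2) by (auto simp: is_lyndon_fact_def)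
  then have "l \<noteq> w" using assms(1) by blast
  then have "concat as \<noteq> [] \<or> concat bs \<noteq> []" using w by (metis append_Nil append_Nil2)
  then have "0 < length (concat as) \<or> 0 < length (concat bs)"
    by (simp only: length_greater_0_conv)
  moreover have "length w = length (concat as) + (length l + length (concat bs))"
    by (subst w) (simp only: length_append)
  ultimately show ?thesis by linarith
qed

lemma st_pos_less:
  assumes "\<not> length l \<le> 1"
  shows "0 < st_pos l \<and> st_pos l < length l \<and> lyndon (drop (st_pos l) l)"
  unfolding st_pos_def
proof (rule LeastI)
  have "drop (length l - 1) l = [last l]"
    using assms by (cases l rule: rev_cases) auto
  then show "0 < length l - 1 \<and> length l - 1 < length l \<and> lyndon (drop (length l - 1) l)"
    using assms by auto
qed


section \<open>The dual bases\<close>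

text \<open>\<open>P\<^sub>l\<close> for a Lyndon word \<open>l\<close>, that is \<open>P\<^sub>x = x\<close> and \<open>P\<^sub>l = [P\<^sub>l\<^sub>1, P\<^sub>l\<^sub>2]\<close> for
  \<open>st l = (l\<^sub>1, l\<^sub>2)\<close>; values at other words are irrelevant.\<close>

function lyndonP :: "'x::linorder list \<Rightarrow> ('x, 'a::comm_ring_1) series" where
  "lyndonP l = (if length l \<le> 1 then word l else bracket (lyndonP (fst (st l))) (lyndonP (snd (st l))))"
  by pat_completeness auto
termination
proof (relation "measure length", goal_cases)
  case (2 l)
  then show ?case using st_pos_less[of l] by (auto simp: st_def)
next
  case (3 l)
  then show ?case using st_pos_less[of l] by (auto simp: st_def)
qed auto

declare lyndonP.simps [simp del]

definition baseP :: "'x::linorder list \<Rightarrow> ('x, 'a::comm_ring_1) series" where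
  "baseP w = foldr conc (map lyndonP (lyndon_fact w)) (word [])"

text \<open>The clause for Lyndon words also covers letters: \<open>S\<^sub>x = x S\<^sub>1 = x\<close>.\<close>

function baseS :: "(complex \<Rightarrow> 'a) \<Rightarrow> 'x::linorder list \<Rightarrow> ('x, 'a::comm_ring_1) series" where
  "baseS \<iota> w =
     (if w = [] then word []
      else if lyndon w then conc (word [hd w]) (baseS \<iota> (tl w))
      else smult_series (\<iota> (1 / (\<Prod>l\<in>set (lyndon_fact w). fact (count_list (lyndon_fact w) l))))
             (foldr shuffle (map (\<lambda>l. baseS \<iota> l) (lyndon_fact w)) (word [])))"
  by pat_completeness auto
termination
proof (relation "measure (\<lambda>(\<iota>, w). length w)", goal_cases)
  case (3 \<iota> w l)
  then show ?case using lyndon_fact_shorter by auto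
qed auto

declare baseS.simps [simp del]


section \<open>Infinite sums and ordered products of series\<close>

text \<open>\<open>T = \<Sum>\<^sub>i\<^sub>\<in>\<^sub>I F\<^sub>i\<close>: every coefficient of the finite partial sums is eventually constant
  (convergence for the discrete topology of the coefficient ring).\<close>

definition series_sums :: "('i \<Rightarrow> ('x, 'a::comm_ring_1) series) \<Rightarrow> 'i set \<Rightarrow> ('x, 'a) series \<Rightarrow> bool" where
  "series_sums F I T \<longleftrightarrow> (\<forall>v. \<forall>\<^sub>F J in finite_subsets_at_top I. (\<Sum>i\<in>J. F i v) = T v)"

text \<open>\<open>T\<close> is the product of the \<open>F\<^sub>i\<close> taken in decreasing order of the indices, in the
  same sense.\<close>

definition decreasing_prod ::
    "('i::linorder \<Rightarrow> ('x, 'a::comm_ring_1) series) \<Rightarrow> 'i set \<Rightarrow> ('x, 'a) series \<Rightarrow> bool" where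
  "decreasing_prod F I T \<longleftrightarrow>
     (\<forall>v. \<forall>\<^sub>F J in finite_subsets_at_top I.
        foldr conc (map F (rev (sorted_list_of_set J))) (word []) v = T v)"

end

theory Submission
  imports Defs
begin

text \<open>Part (i) is the correspondence between Lie series and grouplike series. Write \<open>\<Delta>S\<close> for the function
  \<open>(u, v) \<mapsto> \<langle>S | u \<squnion>\<squnion> v\<rangle>\<close> of two words; \<open>\<Delta>\<close> turns concatenation products into products
  (\<open>coproduct_conc\<close>). A series \<open>S\<close> with constant term \<open>1\<close> is grouplike if \<open>\<Delta>S = S \<otimes> S\<close>, and a
  series \<open>C\<close> is primitive if \<open>\<Delta>C = C \<otimes> 1 + 1 \<otimes> C\<close>.
  Primitive series are exactly the Lie series: brackets of primitive series are primitive, and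
  conversely the Dynkin operator multiplies the primitive elements of degree \<open>n\<close> by \<open>n\<close>
  (\<open>primitive_imp_lie\<close>, \<open>lie_series_primitive\<close>). The exponential maps the primitive series onto the
  grouplike ones (\<open>grouplike_exp_series\<close>, \<open>grouplike_imp_exp_lie\<close>); its inverse is constructed by
  recursion on the length of words. As grouplike series form a group, \<open>H\<^sup>-\<^sup>1 S = e\<^sup>C\<close> for a Lie series
  \<open>C\<close>. In the converse direction, \<open>H = S e\<^bsup>-C\<^esup>\<close> is grouplike (\<open>grouplike_quotient_right\<close>),
  and it solves the equation if and only if \<open>C\<close> has constant coefficients, by the product rule (\<open>solution_iff_constant\<close>).

  In part (ii), the equivalence of (a) and (b) is Radford's theorem: the shuffle product of a
  nonincreasing sequence of Lyndon words is a positive multiple of their concatenation plus smaller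
  words (\<open>shuffle_all_le\<close>), so the coefficients \<open>\<langle>S | w\<rangle>\<close> and the monomials in the \<open>\<langle>S | l\<rangle>\<close>, indexed by
  words through the Lyndon factorization, are triangular over each other. The steps
  from (b) to (c) and from (c) to (d) restrict the set of monomials. If \<open>\<Sum>\<^sub>x c\<^sub>x u\<^sub>x = \<partial>f\<close> contradicts (e),
  then \<open>\<Sum>\<^sub>x c\<^sub>x \<langle>S | x\<rangle> - f\<close> has derivative \<open>0\<close>, so it is a complex constant if there
  are no new constants, and this contradicts (d).
  Finally (e) implies (a) by descent: a linear relation of least degree and with the fewest leading
  words, scaled so that a leading coefficient is \<open>1\<close>, has a derivative that is a smaller relation and
  therefore zero. Then the leading coefficients have derivative \<open>0\<close>, so they are complex constants, again
  in the absence of new constants, and the next lower coefficients contradict (e)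
  (\<open>relation_trivial\<close>). Conditions (e) and (f) are reformulations of each other.\<close>

section \<open>Complex algebras, subrings and derivations\<close>

lemma complex_algebra_of_nat:
  assumes "complex_algebra \<iota>"
  shows "\<iota> (of_nat n) = of_nat n"
proof (induction n)
  case 0
  have "\<iota> 0 = \<iota> 0 + \<iota> 0"
    using assms unfolding complex_algebra_def by (metis add.right_neutral)
  then show ?case by simp
next
  case (Suc n)
  then show ?case using assms by (simp add: complex_algebra_def)
qed

lemma complex_algebra_inverse:
  assumes "complex_algebra \<iota>" "n > 0"
  shows "\<iota> (1 / of_nat n) * of_nat n = 1"
proof -
  have "\<iota> (1 / of_nat n) * \<iota> (of_nat n) = \<iota> (1 / of_nat n * of_nat n)"
    using assms unfolding complex_algebra_def by metis
  also have "1 / of_nat n * of_nat n = (1 :: complex)"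
    using assms by simp
  also have "\<iota> 1 = 1" using assms by (simp add: complex_algebra_def)
  finally show ?thesis by (simp only: complex_algebra_of_nat[OF assms(1)])
qed

lemma complex_algebra_0: "complex_algebra \<iota> \<Longrightarrow> \<iota> 0 = 0"
  using complex_algebra_of_nat[of \<iota> 0] by simp

lemma complex_algebra_eq_0_iff:
  fixes \<iota> :: "complex \<Rightarrow> 'a::idom"
  assumes "complex_algebra \<iota>"
  shows "\<iota> z = 0 \<longleftrightarrow> z = 0"
proof
  assume "\<iota> z = 0"
  then have "\<iota> (z * inverse z) = 0" using assms by (simp add: complex_algebra_def)
  then show "z = 0" using assms by (cases "z = 0") (auto simp: complex_algebra_def)
qed (simp add: complex_algebra_0[OF assms])

lemma
  assumes "differential_subring \<delta> C"
  shows subring_0: "0 \<in> C" and subring_1: "1 \<in> C"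
    and subring_uminus: "x \<in> C \<Longrightarrow> - x \<in> C"
    and subring_add: "x \<in> C \<Longrightarrow> y \<in> C \<Longrightarrow> x + y \<in> C"
    and subring_mult: "x \<in> C \<Longrightarrow> y \<in> C \<Longrightarrow> x * y \<in> C"
    and subring_deriv: "x \<in> C \<Longrightarrow> \<delta> x \<in> C"
  using assms by (auto simp: differential_subring_def)

lemma subring_diff: "differential_subring \<delta> C \<Longrightarrow> x \<in> C \<Longrightarrow> y \<in> C \<Longrightarrow> x - y \<in> C"
  using subring_add[of \<delta> C x "- y"] subring_uminus[of \<delta> C y] by simp

lemma subring_of_nat: "differential_subring \<delta> C \<Longrightarrow> of_nat n \<in> C"
  by (induction n) (auto intro: subring_0 subring_1 subring_add)

lemma
  assumes "derivation \<delta>"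
  shows derivation_add: "\<delta> (x + y) = \<delta> x + \<delta> y"
    and derivation_mult: "\<delta> (x * y) = \<delta> x * y + x * \<delta> y"
  using assms by (auto simp: derivation_def)

lemma derivation_0: "derivation \<delta> \<Longrightarrow> \<delta> 0 = 0"
  using derivation_add[of \<delta> 0 0] by simp

lemma derivation_1: "derivation \<delta> \<Longrightarrow> \<delta> 1 = 0"
  using derivation_mult[of \<delta> 1 1] by simp

lemma derivation_minus: "derivation \<delta> \<Longrightarrow> \<delta> (- x) = - \<delta> x"
  using derivation_add[of \<delta> x "- x"] derivation_0[of \<delta>] by (simp add: eq_neg_iff_add_eq_0 add.commute)

lemma derivation_diff: "derivation \<delta> \<Longrightarrow> \<delta> (x - y) = \<delta> x - \<delta> y"
  using derivation_add[of \<delta> x "- y"] by (simp add: derivation_minus)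

lemma derivation_sum: "derivation \<delta> \<Longrightarrow> \<delta> (\<Sum>i\<in>I. f i) = (\<Sum>i\<in>I. \<delta> (f i))"
  by (induction I rule: infinite_finite_induct) (simp_all add: derivation_0 derivation_add)

section \<open>The concatenation algebra of series\<close>

lemma conc_Nil [simp]: "conc S T [] = S [] * T []"
  by (simp add: conc_def)

text \<open>Concatenation through left quotients \<open>\<lambda>v. S (x # v)\<close>; most inductions over words below
  run on this equation.\<close>

lemma conc_Cons: "conc S T (x # w) = S [] * T (x # w) + conc (\<lambda>v. S (x # v)) T w"
  by (simp add: conc_def sum.atMost_Suc_shift del: sum.atMost_Suc)

lemma conc_add_left: "conc (\<lambda>w. S w + S' w) T = (\<lambda>w. conc S T w + conc S' T w)"
  by (simp add: conc_def algebra_simps sum.distrib)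

lemma conc_add_right: "conc S (\<lambda>w. T w + T' w) = (\<lambda>w. conc S T w + conc S T' w)"
  by (simp add: conc_def algebra_simps sum.distrib)

lemma conc_diff_left: "conc (\<lambda>w. S w - S' w) T = (\<lambda>w. conc S T w - conc S' T w)"
  by (simp add: conc_def algebra_simps sum_subtractf)

lemma conc_scale_left: "conc (\<lambda>w. a * S w) T = (\<lambda>w. a * conc S T w)"
  by (simp add: conc_def algebra_simps sum_distrib_left)

lemma conc_scale_right: "conc S (\<lambda>w. a * T w) = (\<lambda>w. a * conc S T w)"
  by (simp add: conc_def algebra_simps sum_distrib_left)

lemma conc_assoc: "conc (conc S T) U = conc S (conc T U)"
proof
  fix w
  show "conc (conc S T) U w = conc S (conc T U) w"
    by (induction w arbitrary: S)
      (simp_all add: conc_Cons conc_add_left conc_scale_left algebra_simps)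
qed

lemma word_Nil_Nil [simp]: "word [] [] = 1" and word_Nil_Cons [simp]: "word [] (x # w) = 0"
  by (simp_all add: word_def)

lemma conc_zero_left [simp]: "conc (\<lambda>_. 0) S = (\<lambda>_. 0)"
  by (simp add: conc_def)

lemma conc_zero_right [simp]: "conc S (\<lambda>_. 0) = (\<lambda>_. 0)"
  by (simp add: conc_def)

lemma conc_one_left [simp]: "conc (word []) S = S"
proof
  show "conc (word []) S w = S w" for w
    by (cases w) (simp_all add: conc_Cons)
qed

lemma conc_one_right [simp]: "conc S (word []) = S"
proof
  show "conc S (word []) w = S w" for w
    by (induction w arbitrary: S) (simp_all add: conc_Cons)
qed

lemma conc_letter:
  fixes S :: "('x, 'a::comm_ring_1) series"
  shows "conc (word [x]) S w = (case w of [] \<Rightarrow> 0 | y # v \<Rightarrow> if y = x then S v else 0)"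
proof (cases w)
  case (Cons y v)
  have *: "(\<lambda>v. word [x] (y # v)) = (if y = x then word [] else (\<lambda>_. 0 :: 'a))"
    by (auto simp: word_def fun_eq_iff)
  have "word [x] [] = (0 :: 'a)"
    by (simp add: word_def)
  then show ?thesis
    unfolding Cons conc_Cons * by simp
qed (simp add: word_def)

lemma conc_letter_right:
  fixes S :: "('x, 'a::comm_ring_1) series"
  shows "conc S (word [x]) w = (if w \<noteq> [] \<and> last w = x then S (butlast w) else 0)"
proof (induction w arbitrary: S)
  case (Cons y w)
  have "word [x] (y # w) = (if w = [] \<and> y = x then 1 else 0 :: 'a)"
    by (auto simp: word_def)
  then show ?case using Cons by (simp add: conc_Cons)
qed (simp add: word_def)

lemma conc_cong:
  assumes "\<And>v. length v \<le> length w \<Longrightarrow> S v = S' v" "\<And>v. length v \<le> length w \<Longrightarrow> T v = T' v"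
  shows "conc S T w = conc S' T' w"
  using assms by (simp add: conc_def)

text \<open>A series with constant term \<open>1\<close> is invertible, hence cancellable; the induction on the length
  isolates the term in which it contributes its constant coefficient.\<close>

lemma conc_cancel_left:
  assumes "H [] = 1" "conc H X = (\<lambda>_. 0)"
  shows "X = (\<lambda>_. 0)"
proof
  fix w
  show "X w = 0"
  proof (induction w rule: length_induct)
    case (1 w)
    have "conc H X w = (\<Sum>i\<le>length w. if i = 0 then X w else 0)"
      unfolding conc_def by (rule sum.cong) (use 1 assms(1) in auto)
    then show ?case using assms(2) by simp
  qed
qed

lemma conc_cancel_right:
  assumes "E [] = 1" "conc X E = (\<lambda>_. 0)"
  shows "X = (\<lambda>_. 0)"
proof
  fix w
  show "X w = 0"
  proof (induction w rule: length_induct)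
    case (1 w)
    have "conc X E w = (\<Sum>i\<le>length w. if i = length w then X w else 0)"
      unfolding conc_def by (rule sum.cong) (use 1 assms(1) in auto)
    then show ?case using assms(2) by simp
  qed
qed

section \<open>Shuffles and the dual coproduct\<close>

text \<open>The shuffles of two words as a list, in which a word occurs as often as it is obtained.\<close>

fun shuffle_list :: "'x list \<Rightarrow> 'x list \<Rightarrow> 'x list list" where
  "shuffle_list [] v = [v]"
| "shuffle_list (x # u) [] = [x # u]"
| "shuffle_list (x # u) (y # v) =
     map ((#) x) (shuffle_list u (y # v)) @ map ((#) y) (shuffle_list (x # u) v)"

lemma set_shuffle_list: "set (shuffle_list u v) = shuffles u v"
  by (induction u v rule: shuffle_list.induct) auto

lemma mset_shuffles: "w \<in> shuffles u v \<Longrightarrow> mset w = mset u + mset v"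
  by (induction u v arbitrary: w rule: shuffles.induct) auto

lemma shuffle_word_Nil_right [simp]: "shuffle_word u [] = word u"
  by (cases u) auto

lemma shuffle_word_at_Nil: "shuffle_word u v [] = (if u = [] \<and> v = [] then 1 else 0)"
  by (cases "(u, v)" rule: shuffle_word.cases) (auto simp: add_series_def conc_letter word_def)

lemma word_Cons_Cons: "word (x # u) (y # v) = (if y = x then word u v else 0)"
  by (simp add: word_def)

lemma shuffle_word_at_Cons:
  "shuffle_word u v (z # w) =
     (case u of [] \<Rightarrow> 0 | x # u' \<Rightarrow> if z = x then shuffle_word u' v w else 0) +
     (case v of [] \<Rightarrow> 0 | y # v' \<Rightarrow> if z = y then shuffle_word u v' w else 0)"
  by (cases "(u, v)" rule: shuffle_word.cases)
    (auto simp: add_series_def conc_letter word_Cons_Cons split: list.splits)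

lemma shuffle_word_conv_count:
  fixes u :: "'x list"
  shows "shuffle_word u v w = of_nat (count_list (shuffle_list u v) w)"
proof (induction u v arbitrary: w rule: shuffle_list.induct)
  case (3 x u y v)
  have *: "count_list (map ((#) a) ws) w = (case w of [] \<Rightarrow> 0 | b # w' \<Rightarrow> if b = a then count_list ws w' else 0)"
    for a :: 'x and ws
    by (induction ws) (auto split: list.splits)
  show ?case
    using 3 by (simp add: add_series_def conc_letter * split: list.splits)
qed (auto simp: word_def)

lemma shuffle_word_eq_0:
  assumes "mset w \<noteq> mset u + mset v"
  shows "shuffle_word u v w = 0"
proof -
  have "count_list (shuffle_list u v) w = 0"
    using assms mset_shuffles[of w u v] by (auto simp: count_list_0_iff set_shuffle_list)
  then show ?thesis by (simp add: shuffle_word_conv_count)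
qed

lemma sum_list_eq_sum_count_list:
  fixes f :: "'b \<Rightarrow> 'a::comm_semiring_1"
  assumes "finite F" "set xs \<subseteq> F"
  shows "(\<Sum>x\<leftarrow>xs. f x) = (\<Sum>x\<in>F. f x * of_nat (count_list xs x))"
  using assms(2)
proof (induction xs)
  case (Cons y xs)
  have "(\<Sum>x\<in>F. f x * of_nat (count_list (y # xs) x)) =
      (\<Sum>x\<in>F. (if x = y then f x else 0) + f x * of_nat (count_list xs x))"
    by (rule sum.cong) (auto simp: algebra_simps)
  also have "\<dots> = f y + (\<Sum>x\<in>F. f x * of_nat (count_list xs x))"
    using Cons.prems assms(1) by (simp add: sum.distrib)
  finally show ?case using Cons by simp
qed simp

abbreviation words_of :: "'x multiset \<Rightarrow> 'x list set" where
  "words_of \<alpha> \<equiv> {w. mset w = \<alpha>}"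

lemma finite_words_of: "finite (words_of \<alpha>)"
proof -
  obtain xs where "mset xs = \<alpha>" using ex_mset by blast
  then show ?thesis using mset_eq_finite[of xs] by simp
qed

text \<open>The coproduct dual to the shuffle product, \<open>\<langle>S | u \<squnion>\<squnion> v\<rangle>\<close> as a function of two words. The
  list of shuffles has the advantage over the pairing of not depending on which
  multiplicities vanish in the ring.\<close>

definition coproduct :: "('x, 'a::comm_ring_1) series \<Rightarrow> 'x list \<Rightarrow> 'x list \<Rightarrow> 'a" where
  "coproduct S u v = (\<Sum>w\<leftarrow>shuffle_list u v. S w)"

lemma coproduct_conv_sum:
  "coproduct S u v = (\<Sum>w\<in>words_of (mset u + mset v). S w * shuffle_word u v w)"
  unfolding coproduct_def shuffle_word_conv_count
  by (rule sum_list_eq_sum_count_list[OF finite_words_of]) (auto simp: set_shuffle_list mset_shuffles)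

lemma pairing_shuffle_word: "pairing S (shuffle_word u v) = coproduct S u v"
  unfolding pairing_def coproduct_conv_sum
  by (rule sum.mono_neutral_left[OF finite_words_of]) (use shuffle_word_eq_0 in fastforce)+

lemma grouplike_alt: "grouplike S \<longleftrightarrow> S [] = 1 \<and> (\<forall>u v. coproduct S u v = S u * S v)"
  by (simp add: grouplike_def pairing_shuffle_word)

lemma coproduct_Nil_left [simp]: "coproduct S [] v = S v"
  and coproduct_Nil_right [simp]: "coproduct S u [] = S u"
  and coproduct_Cons_Cons: "coproduct S (x # u) (y # v) =
    coproduct (\<lambda>w. S (x # w)) u (y # v) + coproduct (\<lambda>w. S (y # w)) (x # u) v"
  by (simp_all add: coproduct_def o_def) (cases u; simp)

lemma coproduct_cong:
  assumes "\<And>w. mset w = mset u + mset v \<Longrightarrow> S w = T w"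
  shows "coproduct S u v = coproduct T u v"
  unfolding coproduct_conv_sum by (rule sum.cong) (use assms in auto)

lemma coproduct_add: "coproduct (\<lambda>w. S w + T w) u v = coproduct S u v + coproduct T u v"
  and coproduct_diff: "coproduct (\<lambda>w. S w - T w) u v = coproduct S u v - coproduct T u v"
  and coproduct_scale: "coproduct (\<lambda>w. a * S w) u v = a * coproduct S u v"
  by (simp_all add: coproduct_conv_sum algebra_simps sum.distrib sum_subtractf sum_distrib_left)

lemma coproduct_sum: "coproduct (\<lambda>w. \<Sum>i\<in>I. F i w) u v = (\<Sum>i\<in>I. coproduct (F i) u v)"
  unfolding coproduct_conv_sum by (simp add: sum_distrib_right sum.swap[of _ I])

text \<open>The coproduct is multiplicative for concatenation: in a shuffle of \<open>u\<close> and \<open>v\<close>, a prefix is a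
  shuffle of prefixes of \<open>u\<close> and \<open>v\<close>, and the rest a shuffle of the remaining suffixes.\<close>

lemma coproduct_conc:
  "coproduct (conc S T) u v =
     (\<Sum>i\<le>length u. \<Sum>j\<le>length v.
        coproduct S (take i u) (take j v) * coproduct T (drop i u) (drop j v))"
proof (induction u v arbitrary: S rule: shuffle_list.induct)
  case (1 v)
  then show ?case by (simp add: conc_def)
next
  case (2 x u)
  then show ?case by (simp add: conc_def)
next
  case (3 x u y v)
  let ?Sx = "\<lambda>w. S (x # w)" and ?Sy = "\<lambda>w. S (y # w)"
  have "coproduct (conc S T) (x # u) (y # v) =
      S [] * coproduct T (x # u) (y # v) +
      coproduct (conc ?Sx T) u (y # v) + coproduct (conc ?Sy T) (x # u) v"
    by (simp add: coproduct_Cons_Cons conc_Cons coproduct_add coproduct_scale algebra_simps)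
  also have "\<dots> = (\<Sum>i\<le>length (x # u). \<Sum>j\<le>length (y # v).
        coproduct S (take i (x # u)) (take j (y # v)) * coproduct T (drop i (x # u)) (drop j (y # v)))"
    unfolding 3
    by (simp add: sum.atMost_Suc_shift coproduct_Cons_Cons algebra_simps sum.distrib del: sum.atMost_Suc)
  finally show ?case .
qed

section \<open>Grouplike series\<close>

lemma grouplike_Nil: "grouplike S \<Longrightarrow> S [] = 1"
  and grouplike_coproduct: "grouplike S \<Longrightarrow> coproduct S u v = S u * S v"
  by (simp_all add: grouplike_alt)

text \<open>If \<open>H E\<close> and \<open>E\<close> are grouplike, so is \<open>H\<close>: expanding \<open>\<langle>H E | u \<squnion>\<squnion> v\<rangle>\<close> in two ways and
  cancelling all terms in which \<open>H\<close> meets shorter words leaves the equation for \<open>H\<close> at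
  \<open>(u, v)\<close>.\<close>

lemma grouplike_quotient_right:
  fixes H :: "('x, 'a::comm_ring_1) series"
  assumes HE: "grouplike (conc H E)" and E: "grouplike E"
  shows "grouplike H"
proof -
  have H0: "H [] = 1" using HE E by (simp add: grouplike_alt)
  have "coproduct H u v = H u * H v" for u v
  proof (induction "length u + length v" arbitrary: u v rule: less_induct)
    case less
    let ?f = "\<lambda>i j. coproduct H (take i u) (take j v) * coproduct E (drop i u) (drop j v)"
    let ?g = "\<lambda>i j. (H (take i u) * E (drop i u)) * (H (take j v) * E (drop j v))"
    have "(\<Sum>i\<le>length u. \<Sum>j\<le>length v. ?f i j) = coproduct (conc H E) u v"
      by (simp add: coproduct_conc)
    also have "\<dots> = conc H E u * conc H E v"
      by (rule grouplike_coproduct[OF HE])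
    also have "\<dots> = (\<Sum>i\<le>length u. \<Sum>j\<le>length v. ?g i j)"
      unfolding conc_def by (rule sum_product)
    finally have "0 = (\<Sum>i\<le>length u. \<Sum>j\<le>length v. ?f i j - ?g i j)"
      by (simp add: sum_subtractf)
    also have "\<dots> = (\<Sum>i\<le>length u. if i = length u then
        (\<Sum>j\<le>length v. if j = length v then coproduct H u v - H u * H v else 0) else 0)"
    proof (rule sum.cong[OF refl])
      fix i assume i: "i \<in> {..length u}"
      have eq: "?f i j - ?g i j = 0" if "j \<in> {..length v}" "i \<noteq> length u \<or> j \<noteq> length v" for j
      proof -
        have "length (take i u) + length (take j v) < length u + length v"
          using i that by auto
        then show ?thesis using less grouplike_coproduct[OF E] by simp
      qed
      show "(\<Sum>j\<le>length v. ?f i j - ?g i j) = (if i = length u then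
        (\<Sum>j\<le>length v. if j = length v then coproduct H u v - H u * H v else 0) else 0)"
      proof (cases "i = length u")
        case True
        have "(\<Sum>j\<le>length v. ?f i j - ?g i j) =
            (\<Sum>j\<le>length v. if j = length v then coproduct H u v - H u * H v else 0)"
        proof (rule sum.cong[OF refl])
          fix j assume j: "j \<in> {..length v}"
          show "?f i j - ?g i j = (if j = length v then coproduct H u v - H u * H v else 0)"
            using eq[OF j] True by (auto simp: grouplike_Nil[OF E])
        qed
        then show ?thesis using True by simp
      next
        case False
        then have "(\<Sum>j\<le>length v. ?f i j - ?g i j) = 0"
          using eq by (intro sum.neutral) auto
        then show ?thesis using False by simp
      qed
    qed
    also have "\<dots> = coproduct H u v - H u * H v" by simp
    finally show ?case by simp
  qed
  with H0 show ?thesis by (simp add: grouplike_alt)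
qed

lemma grouplike_conc:
  assumes S: "grouplike S" and T: "grouplike T"
  shows "grouplike (conc S T)"
proof -
  have "coproduct (conc S T) u v = conc S T u * conc S T v" for u v
    unfolding coproduct_conc unfolding conc_def sum_product
    by (simp add: grouplike_coproduct[OF S] grouplike_coproduct[OF T] algebra_simps)
  then show ?thesis using S T by (simp add: grouplike_alt)
qed

section \<open>The antipode and the Dynkin operator\<close>

text \<open>For \<open>c = 1\<close> this is the coefficient of \<open>w\<close> in the convolution of the identity with the antipode
  \<open>w \<mapsto> (-1)\<^bsup>|w|\<^esup> rev w\<close> of the shuffle algebra, evaluated at \<open>v\<close>; for \<open>c i = i\<close> the identity is
  replaced by the grading operator.\<close>

definition antipode_sum :: "(nat \<Rightarrow> 'a) \<Rightarrow> 'x list \<Rightarrow> 'x list \<Rightarrow> 'a::comm_ring_1" where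
  "antipode_sum c v w = (\<Sum>i\<le>length v.
     (- 1) ^ (length v - i) * c i * shuffle_word (take i v) (rev (drop i v)) w)"

lemma antipode_sum_at_Nil: "antipode_sum c v [] = (if v = [] then c 0 else 0)"
proof -
  have "antipode_sum c v [] = (\<Sum>i\<le>length v. if i = 0 then if v = [] then c 0 else 0 else 0)"
    unfolding antipode_sum_def by (rule sum.cong) (auto simp: shuffle_word_at_Nil)
  then show ?thesis by simp
qed

text \<open>The first letter of a shuffle of \<open>take i v\<close> with the reversal of \<open>drop i v\<close> is the first or the
  last letter of \<open>v\<close>.\<close>

lemma antipode_sum_at_Cons:
  "antipode_sum c v (z # w) =
     (if v \<noteq> [] \<and> hd v = z then antipode_sum (\<lambda>i. c (Suc i)) (tl v) w else 0) -
     (if v \<noteq> [] \<and> last v = z then antipode_sum c (butlast v) w else 0)"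
proof -
  let ?s = "\<lambda>v i. (- 1) ^ (length v - i) :: 'a"
  let ?A = "\<lambda>i. ?s v i * c i * (case take i v of [] \<Rightarrow> 0 | x # u \<Rightarrow>
      if z = x then shuffle_word u (rev (drop i v)) w else 0)"
  let ?B = "\<lambda>i. ?s v i * c i * (case rev (drop i v) of [] \<Rightarrow> 0 | y # u \<Rightarrow>
      if z = y then shuffle_word (take i v) u w else 0)"
  have "antipode_sum c v (z # w) = (\<Sum>i\<le>length v. ?A i) + (\<Sum>i\<le>length v. ?B i)"
    unfolding antipode_sum_def shuffle_word_at_Cons by (simp add: algebra_simps sum.distrib)
  moreover have "(\<Sum>i\<le>length v. ?A i) =
      (if v \<noteq> [] \<and> hd v = z then antipode_sum (\<lambda>i. c (Suc i)) (tl v) w else 0)"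
    by (cases v) (auto simp: antipode_sum_def sum.atMost_Suc_shift simp del: sum.atMost_Suc)
  moreover have "(\<Sum>i\<le>length v. ?B i) =
      - (if v \<noteq> [] \<and> last v = z then antipode_sum c (butlast v) w else 0)"
  proof (cases v rule: rev_cases)
    case (snoc u y)
    have "(\<Sum>i\<le>length v. ?B i) = (\<Sum>i\<le>length u. ?B i)"
      using snoc by simp
    also have "\<dots> = (\<Sum>i\<le>length u. - (if y = z then
        ?s u i * c i * shuffle_word (take i u) (rev (drop i u)) w else 0))"
      by (rule sum.cong) (use snoc in \<open>auto simp: Suc_diff_le\<close>)
    also have "\<dots> = - (if v \<noteq> [] \<and> last v = z then antipode_sum c (butlast v) w else 0)"
      using snoc by (auto simp: antipode_sum_def sum_negf)
    finally show ?thesis .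
  qed auto
  ultimately show ?thesis by simp
qed

text \<open>The antipode is the convolution inverse of the identity: the terms where the first letter of \<open>v\<close>
  is removed cancel those where the last letter is removed.\<close>

lemma antipode_sum_one: "antipode_sum (\<lambda>_. 1) v w = (if v = [] \<and> w = [] then 1 else 0)"
proof (induction w arbitrary: v)
  case Nil
  show ?case by (simp add: antipode_sum_at_Nil)
next
  case (Cons z w)
  show ?case
  proof (cases v)
    case Nil
    then show ?thesis by (simp add: antipode_sum_at_Cons)
  next
    case (Cons x u)
    then show ?thesis by (cases u) (auto simp: antipode_sum_at_Cons Cons.IH)
  qed
qed

lemma sum_coproduct_antipode:
  "(\<Sum>i\<le>length v. (- 1) ^ (length v - i) * c i * coproduct S (take i v) (rev (drop i v))) =
     (\<Sum>w\<in>words_of (mset v). S w * antipode_sum c v w)"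
proof -
  have "mset (take i v) + mset (rev (drop i v)) = mset v" for i
    by (metis append_take_drop_id mset_append mset_rev)
  then have "(\<Sum>i\<le>length v. (- 1) ^ (length v - i) * c i * coproduct S (take i v) (rev (drop i v))) =
     (\<Sum>i\<le>length v. \<Sum>w\<in>words_of (mset v). S w * ((- 1) ^ (length v - i) * c i *
        shuffle_word (take i v) (rev (drop i v)) w))"
    by (simp only: coproduct_conv_sum) (simp add: sum_distrib_left algebra_simps)
  also have "\<dots> = (\<Sum>w\<in>words_of (mset v). S w * antipode_sum c v w)"
    unfolding antipode_sum_def by (subst sum.swap) (simp add: sum_distrib_left)
  finally show ?thesis .
qed

text \<open>On a grouplike series the shuffle product becomes the product of coefficients, so that the
  antipode identity turns into an identity between coefficients of a concatenation product.\<close>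

lemma grouplike_inverse:
  assumes "grouplike H"
  shows "conc H (\<lambda>w. (- 1) ^ length w * H (rev w)) = word []"
proof
  fix v
  have "conc H (\<lambda>w. (- 1) ^ length w * H (rev w)) v =
      (\<Sum>i\<le>length v. (- 1) ^ (length v - i) * 1 * coproduct H (take i v) (rev (drop i v)))"
    by (simp add: conc_def grouplike_coproduct[OF assms] algebra_simps)
  also have "\<dots> = word [] v"
  proof (cases v)
    case Nil
    then show ?thesis using grouplike_Nil[OF assms] by simp
  next
    case (Cons x u)
    then show ?thesis unfolding sum_coproduct_antipode antipode_sum_one by simp
  qed
  finally show "conc H (\<lambda>w. (- 1) ^ length w * H (rev w)) v = word [] v" .
qed

text \<open>The right-normed bracketing \<open>[x\<^sub>1, [x\<^sub>2, \<dots>, [x\<^sub>n\<^sub>-\<^sub>1, x\<^sub>n]]]\<close>.\<close>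

fun dynkin :: "'x list \<Rightarrow> ('x, 'a::comm_ring_1) series" where
  "dynkin [] = (\<lambda>_. 0)"
| "dynkin [x] = word [x]"
| "dynkin (x # y # w) = bracket (word [x]) (dynkin (y # w))"

lemma dynkin_lie: "dynkin w \<in> lie_polys"
  by (induction w rule: dynkin.induct) (auto intro: lie_polys.intros)

text \<open>The Dynkin operator is, up to passing to the adjoint, the convolution of the grading operator with
  the antipode. Both sides satisfy the same recursion in \<open>w\<close>: shifting the weights \<open>c i = i\<close> by one
  adds a multiple of the sum with weights \<open>1\<close>, which vanishes.\<close>

lemma antipode_sum_degree:
  fixes v w :: "'x list"
  shows "antipode_sum of_nat v w = (dynkin w v :: 'a::comm_ring_1)"
proof (induction w arbitrary: v rule: dynkin.induct)
  case 1
  then show ?case by (simp add: antipode_sum_at_Nil)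
next
  case (2 x)
  then show ?case by (cases v) (auto simp: antipode_sum_at_Cons antipode_sum_at_Nil word_def)
next
  case (3 x y w)
  have "antipode_sum (\<lambda>i. of_nat (Suc i)) u (y # w) = (dynkin (y # w) u :: 'a)" for u
  proof -
    have "antipode_sum (\<lambda>i. of_nat (Suc i)) u (y # w) =
        (antipode_sum (\<lambda>_. 1) u (y # w) + antipode_sum of_nat u (y # w) :: 'a)"
      by (simp add: antipode_sum_def algebra_simps sum.distrib)
    then show ?thesis by (simp add: antipode_sum_one 3)
  qed
  then show ?case
    by (subst antipode_sum_at_Cons)
      (auto simp: 3 bracket_def conc_letter conc_letter_right split: list.splits)
qed

lemma dynkin_eq_0: "mset w \<noteq> mset v \<Longrightarrow> dynkin w v = 0"
proof -
  assume *: "mset w \<noteq> mset v"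
  have "mset (take i v) + mset (rev (drop i v)) = mset v" for i
    by (metis append_take_drop_id mset_append mset_rev)
  then show ?thesis
    using * by (simp add: antipode_sum_degree[symmetric] antipode_sum_def shuffle_word_eq_0)
qed

section \<open>Primitive series are the Lie series\<close>

text \<open>That is, \<open>\<Delta>C = C \<otimes> 1 + 1 \<otimes> C\<close>.\<close>

definition primitive :: "('x, 'a::comm_ring_1) series \<Rightarrow> bool" where
  "primitive C \<longleftrightarrow> C [] = 0 \<and> (\<forall>u v. u \<noteq> [] \<and> v \<noteq> [] \<longrightarrow> coproduct C u v = 0)"

lemma lie_polys_sum:
  assumes "finite F" "\<And>i. i \<in> F \<Longrightarrow> Q i \<in> lie_polys"
  shows "(\<lambda>v. \<Sum>i\<in>F. c i * Q i v) \<in> lie_polys"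
  using assms
proof (induction F rule: finite_induct)
  case empty
  then show ?case by (simp add: lie_polys.zero)
next
  case (insert i F)
  have "add_series (smult_series (c i) (Q i)) (\<lambda>v. \<Sum>i\<in>F. c i * Q i v) \<in> lie_polys"
    using insert by (intro lie_polys.add lie_polys.smult) auto
  then show ?case using insert by (simp add: add_series_def smult_series_def)
qed

text \<open>The theorem of Dynkin, Specht and Wever: on primitive series the sum with weights \<open>c i = i\<close>
  keeps only its last term, so the homogeneous part of degree \<open>n\<close> is \<open>1 / n\<close> times its image under
  the right-normed bracketing.\<close>

lemma primitive_imp_lie:
  fixes C :: "('x, 'a::comm_ring_1) series" and \<iota> :: "complex \<Rightarrow> 'a"
  assumes alg: "complex_algebra \<iota>" and C: "primitive C"
  shows "C \<in> lie_series"
proof -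
  have "multihom_component \<alpha> C \<in> lie_polys" for \<alpha>
  proof (cases "\<alpha> = {#}")
    case True
    then have "multihom_component \<alpha> C = (\<lambda>_. 0)"
      using C by (auto simp: multihom_component_def primitive_def)
    then show ?thesis by (simp add: lie_polys.zero)
  next
    case False
    let ?n = "size \<alpha>"
    let ?c = "\<iota> (1 / of_nat ?n)"
    have n: "?n > 0" using False by (simp add: nonempty_has_size)
    have "(\<Sum>w\<in>words_of \<alpha>. ?c * C w * dynkin w v) = multihom_component \<alpha> C v" for v
    proof (cases "mset v = \<alpha>")
      case True
      then have len: "length v = ?n" by auto
      have "(\<Sum>w\<in>words_of \<alpha>. C w * dynkin w v) =
          (\<Sum>i\<le>length v. (- 1) ^ (length v - i) * of_nat i * coproduct C (take i v) (rev (drop i v)))"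
        unfolding sum_coproduct_antipode using True by (simp add: antipode_sum_degree)
      also have "\<dots> = (\<Sum>i\<le>length v. if i = length v then of_nat (length v) * C v else 0)"
      proof (rule sum.cong[OF refl])
        fix i assume i: "i \<in> {..length v}"
        show "(- 1) ^ (length v - i) * of_nat i * coproduct C (take i v) (rev (drop i v)) =
            (if i = length v then of_nat (length v) * C v else 0)"
          using C i by (cases "i = 0"; cases "v = []") (auto simp: primitive_def)
      qed
      also have "\<dots> = of_nat ?n * C v" by (simp add: len)
      finally have "?c * (\<Sum>w\<in>words_of \<alpha>. C w * dynkin w v) = ?c * of_nat ?n * C v"
        by (simp only: mult.assoc)
      moreover have "?c * (\<Sum>w\<in>words_of \<alpha>. C w * dynkin w v) = (\<Sum>w\<in>words_of \<alpha>. ?c * C w * dynkin w v)"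
        by (simp add: sum_distrib_left mult.assoc)
      ultimately show ?thesis
        using complex_algebra_inverse[OF alg n] True by (simp add: multihom_component_def)
    next
      case False
      then have "dynkin w v = (0 :: 'a)" if "w \<in> words_of \<alpha>" for w
        by (intro dynkin_eq_0) (use that in auto)
      then show ?thesis using False by (simp add: multihom_component_def)
    qed
    then have "multihom_component \<alpha> C = (\<lambda>v. \<Sum>w\<in>words_of \<alpha>. ?c * C w * dynkin w v)"
      by auto
    also have "\<dots> \<in> lie_polys"
      by (rule lie_polys_sum) (auto simp: finite_words_of dynkin_lie)
    finally show ?thesis .
  qed
  moreover have "C [] = 0" using C by (simp add: primitive_def)
  ultimately show ?thesis by (simp add: lie_series_def)
qed

text \<open>The Leibniz rule, since \<open>\<Delta>P = P \<otimes> 1 + 1 \<otimes> P\<close> and the coproduct is multiplicative.\<close>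

lemma coproduct_primitive_conc:
  assumes P: "primitive P"
  shows "coproduct (conc P T) u v =
    (\<Sum>j\<le>length v. P (take j v) * coproduct T u (drop j v)) +
    (\<Sum>i\<le>length u. P (take i u) * coproduct T (drop i u) v)"
proof -
  let ?X = "\<lambda>i j. coproduct T (drop i u) (drop j v)"
  have "coproduct (conc P T) u v = (\<Sum>i\<le>length u. \<Sum>j\<le>length v.
      (if i = 0 then P (take j v) * ?X 0 j else 0) + (if j = 0 then P (take i u) * ?X i 0 else 0))"
    unfolding coproduct_conc
  proof (intro sum.cong refl)
    fix i j assume "i \<in> {..length u}" "j \<in> {..length v}"
    then show "coproduct P (take i u) (take j v) * ?X i j =
      (if i = 0 then P (take j v) * ?X 0 j else 0) + (if j = 0 then P (take i u) * ?X i 0 else 0)"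
      using P by (cases "u = []"; cases "v = []") (auto simp: primitive_def)
  qed
  also have "\<dots> = (\<Sum>j\<le>length v. P (take j v) * coproduct T u (drop j v)) +
    (\<Sum>i\<le>length u. P (take i u) * coproduct T (drop i u) v)"
    unfolding sum.distrib by (subst sum.swap) simp
  finally show ?thesis .
qed

lemma primitive_bracket:
  assumes P: "primitive P" and Q: "primitive Q"
  shows "primitive (bracket P Q)"
proof -
  have *: "coproduct (conc P Q) u v = P v * Q u + P u * Q v"
    if P: "primitive P" and Q: "primitive Q" and "u \<noteq> []" "v \<noteq> []"
    for P Q :: "('a, 'b) series" and u v
  proof -
    have "(\<Sum>j\<le>length v. P (take j v) * coproduct Q u (drop j v)) =
        (\<Sum>j\<le>length v. if j = length v then P v * Q u else 0)"
      by (rule sum.cong) (use that in \<open>auto simp: primitive_def\<close>)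
    moreover have "(\<Sum>i\<le>length u. P (take i u) * coproduct Q (drop i u) v) =
        (\<Sum>i\<le>length u. if i = length u then P u * Q v else 0)"
      by (rule sum.cong) (use that in \<open>auto simp: primitive_def\<close>)
    ultimately show ?thesis
      unfolding coproduct_primitive_conc[OF P] by simp
  qed
  show ?thesis
    using P Q by (auto simp: primitive_def bracket_def coproduct_diff *[OF P Q] *[OF Q P])
qed

lemma lie_polys_primitive: "P \<in> lie_polys \<Longrightarrow> primitive P"
proof (induction P rule: lie_polys.induct)
  case zero
  then show ?case by (simp add: primitive_def coproduct_def)
next
  case (letter x)
  have "coproduct (word [x]) u v = (0 :: 'b)" if "u \<noteq> []" "v \<noteq> []" for u v
  proof -
    have "coproduct (word [x]) u v = coproduct (\<lambda>_. 0 :: 'b) u v"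
    proof (rule coproduct_cong)
      fix w assume "mset w = mset u + mset v"
      then have "length w = length u + length v" by (metis size_mset size_union)
      then show "word [x] w = (0 :: 'b)" using that by (cases u; cases v) (auto simp: word_def)
    qed
    then show ?thesis by (simp add: coproduct_def)
  qed
  moreover have "word [x] [] = (0 :: 'b)" by (simp add: word_def)
  ultimately show ?case unfolding primitive_def by blast
next
  case (add P Q)
  then show ?case by (simp add: primitive_def add_series_def coproduct_add)
next
  case (smult P a)
  then show ?case by (simp add: primitive_def smult_series_def coproduct_scale)
next
  case (bracket P Q)
  then show ?case by (simp add: primitive_bracket)
qed

text \<open>The defect \<open>\<langle>C | u \<squnion>\<squnion> v\<rangle>\<close> involves a single multihomogeneous component of \<open>C\<close>.\<close>

lemma lie_series_primitive:
  assumes "C \<in> lie_series"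
  shows "primitive C"
proof -
  have "coproduct C u v = 0" if "u \<noteq> []" "v \<noteq> []" for u v
  proof -
    let ?\<alpha> = "mset u + mset v"
    have "coproduct C u v = coproduct (multihom_component ?\<alpha> C) u v"
      by (rule coproduct_cong) (simp add: multihom_component_def)
    also have "\<dots> = 0"
      using lie_polys_primitive[of "multihom_component ?\<alpha> C"] assms that
      by (simp add: lie_series_def primitive_def)
    finally show ?thesis .
  qed
  then show ?thesis using assms by (simp add: primitive_def lie_series_def)
qed

section \<open>Exponentials\<close>

abbreviation conc_power :: "('x, 'a::comm_ring_1) series \<Rightarrow> nat \<Rightarrow> ('x, 'a) series" where
  "conc_power C n \<equiv> (conc C ^^ n) (word [])"

lemma conc_power_eq_0:
  assumes "C [] = 0" "length w < n"
  shows "conc_power C n w = 0"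
  using assms(2)
proof (induction n arbitrary: w)
  case (Suc n)
  have "C (take i w) * conc_power C n (drop i w) = 0" if "i \<le> length w" for i
    using assms(1) Suc that by (cases "i = 0") auto
  then show ?case by (simp add: conc_def[of C "conc_power C n"])
qed simp

lemma exp_series_Nil [simp]: "complex_algebra \<iota> \<Longrightarrow> exp_series \<iota> C [] = 1"
  by (simp add: exp_series_def complex_algebra_def)

lemma exp_series_upto:
  assumes "C [] = 0" "length w \<le> N"
  shows "exp_series \<iota> C w = (\<Sum>n\<le>N. \<iota> (1 / fact n) * conc_power C n w)"
  unfolding exp_series_def
  by (rule sum.mono_neutral_left) (use assms in \<open>auto simp: conc_power_eq_0\<close>)

lemma pascal_sum:
  fixes f :: "nat \<Rightarrow> nat \<Rightarrow> 'a::comm_ring_1"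
  shows "(\<Sum>k\<le>n. of_nat (n choose k) * (f k (Suc (n - k)) + f (Suc k) (n - k))) =
    (\<Sum>k\<le>Suc n. of_nat (Suc n choose k) * f k (Suc n - k))"
proof -
  have "(\<Sum>k\<le>n. of_nat (n choose k) * f k (Suc (n - k))) =
      (\<Sum>k\<le>Suc n. of_nat (n choose k) * f k (Suc n - k))"
    by (simp add: Suc_diff_le binomial_eq_0)
  also have "\<dots> = f 0 (Suc n) + (\<Sum>k\<le>n. of_nat (n choose Suc k) * f (Suc k) (n - k))"
    by (subst sum.atMost_Suc_shift) simp
  finally show ?thesis
    by (subst sum.atMost_Suc_shift) (simp add: algebra_simps sum.distrib)
qed

lemma coproduct_word_Nil:
  "coproduct (word []) u v = (word [] u * word [] v :: 'a::comm_ring_1)"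
proof (cases "u = [] \<or> v = []")
  case False
  have "coproduct (word []) u v = (coproduct (\<lambda>_. 0) u v :: 'a)"
    by (rule coproduct_cong) (use False in \<open>auto simp: word_def\<close>)
  then show ?thesis using False by (simp add: coproduct_def word_def)
qed auto

lemma sum_conc:
  "(\<Sum>j\<le>length v. C (take j v) * (\<Sum>k\<in>K. a k * T k (drop j v))) = (\<Sum>k\<in>K. a k * conc C (T k) v)"
  unfolding conc_def sum_distrib_left by (subst sum.swap) (simp add: mult_ac)

text \<open>The binomial formula for the commuting summands \<open>C \<otimes> 1\<close> and \<open>1 \<otimes> C\<close> of \<open>\<Delta>C\<close>.\<close>

lemma coproduct_conc_power:
  assumes C: "primitive C"
  shows "coproduct (conc_power C n) u v =
    (\<Sum>k\<le>n. of_nat (n choose k) * (conc_power C k u * conc_power C (n - k) v))"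
proof (induction n arbitrary: u v)
  case 0
  then show ?case by (simp add: coproduct_word_Nil)
next
  case (Suc n)
  let ?p = "conc_power C"
  have "coproduct (?p (Suc n)) u v =
      (\<Sum>j\<le>length v. C (take j v) * coproduct (?p n) u (drop j v)) +
      (\<Sum>i\<le>length u. C (take i u) * coproduct (?p n) (drop i u) v)"
    by (simp add: coproduct_primitive_conc[OF C])
  also have "(\<Sum>j\<le>length v. C (take j v) * coproduct (?p n) u (drop j v)) =
      (\<Sum>k\<le>n. of_nat (n choose k) * (?p k u * ?p (Suc (n - k)) v))"
    using sum_conc[of C v "\<lambda>k. of_nat (n choose k) * ?p k u" "\<lambda>k. ?p (n - k)" "{..n}"]
    by (simp add: Suc mult.assoc)
  also have "(\<Sum>i\<le>length u. C (take i u) * coproduct (?p n) (drop i u) v) =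
      (\<Sum>k\<le>n. of_nat (n choose k) * (?p (Suc k) u * ?p (n - k) v))"
    using sum_conc[of C u "\<lambda>k. of_nat (n choose k) * ?p (n - k) v" "\<lambda>k. ?p k" "{..n}"]
    by (simp add: Suc mult_ac)
  also have "(\<Sum>k\<le>n. of_nat (n choose k) * (?p k u * ?p (Suc (n - k)) v)) +
      (\<Sum>k\<le>n. of_nat (n choose k) * (?p (Suc k) u * ?p (n - k) v)) =
      (\<Sum>k\<le>Suc n. of_nat (Suc n choose k) * (?p k u * ?p (Suc n - k) v))"
    using pascal_sum[of n "\<lambda>a b. ?p a u * ?p b v"] by (simp add: sum.distrib distrib_left)
  finally show ?case .
qed

text \<open>The functional equation \<open>e\<^bsup>C \<otimes> 1 + 1 \<otimes> C\<^esup> = e\<^sup>C \<otimes> e\<^sup>C\<close>.\<close>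

lemma grouplike_exp_series:
  fixes C :: "('x, 'a::comm_ring_1) series"
  assumes alg: "complex_algebra \<iota>" and C: "primitive C"
  shows "grouplike (exp_series \<iota> C)"
proof -
  have C0: "C [] = 0" using C by (simp add: primitive_def)
  have "coproduct (exp_series \<iota> C) u v = exp_series \<iota> C u * exp_series \<iota> C v" for u v
  proof -
    let ?N = "length u + length v"
    let ?g = "\<lambda>i j. (\<iota> (1 / fact i) * conc_power C i u) * (\<iota> (1 / fact j) * conc_power C j v)"
    have "coproduct (exp_series \<iota> C) u v =
        coproduct (\<lambda>w. \<Sum>n\<le>?N. \<iota> (1 / fact n) * conc_power C n w) u v"
    proof (rule coproduct_cong)
      fix w assume "mset w = mset u + mset v"
      then have "length w = ?N" by (metis size_mset size_union)
      then show "exp_series \<iota> C w = (\<Sum>n\<le>?N. \<iota> (1 / fact n) * conc_power C n w)"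
        by (simp add: exp_series_upto C0)
    qed
    also have "\<dots> = (\<Sum>n\<le>?N. \<Sum>k\<le>n. ?g k (n - k))"
      unfolding coproduct_sum coproduct_scale coproduct_conc_power[OF C] sum_distrib_left
    proof (intro sum.cong refl)
      fix n k :: nat assume "k \<in> {..n}"
      then have "1 / fact n * of_nat (n choose k) = (1 / fact k) * (1 / fact (n - k) :: complex)"
        by (simp add: binomial_fact field_simps)
      then have "\<iota> (1 / fact n * of_nat (n choose k)) = \<iota> ((1 / fact k) * (1 / fact (n - k)))"
        by (rule arg_cong)
      then have "\<iota> (1 / fact n) * of_nat (n choose k) = \<iota> (1 / fact k) * \<iota> (1 / fact (n - k))"
        using alg complex_algebra_of_nat[OF alg] unfolding complex_algebra_def by metis
      then have "\<iota> (1 / fact n) * of_nat (n choose k) * (conc_power C k u * conc_power C (n - k) v) =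
          \<iota> (1 / fact k) * \<iota> (1 / fact (n - k)) * (conc_power C k u * conc_power C (n - k) v)"
        by (rule arg_cong)
      then show "\<iota> (1 / fact n) * (of_nat (n choose k) * (conc_power C k u * conc_power C (n - k) v)) =
          ?g k (n - k)"
        by (simp only: mult_ac)
    qed
    also have "\<dots> = (\<Sum>(i, j)\<in>{(i, j). i + j \<le> ?N}. ?g i j)"
      by (rule sum.triangle_reindex_eq[symmetric])
    \<comment> \<open>both index sets contain all pairs with \<open>i \<le> |u|\<close> and \<open>j \<le> |v|\<close>, and the other terms vanish\<close>
    also have "\<dots> = (\<Sum>(i, j)\<in>{..length u} \<times> {..length v}. ?g i j)"
    proof (rule sum.mono_neutral_right)
      show "finite {(i, j). i + j \<le> ?N}"
        by (rule finite_subset[of _ "{..?N} \<times> {..?N}"]) auto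
      show "\<forall>p\<in>{(i, j). i + j \<le> ?N} - {..length u} \<times> {..length v}. (case p of (i, j) \<Rightarrow> ?g i j) = 0"
      proof
        fix p assume "p \<in> {(i, j). i + j \<le> ?N} - {..length u} \<times> {..length v}"
        then obtain i j where p: "p = (i, j)" "length u < i \<or> length v < j" by (cases p) auto
        then show "(case p of (i, j) \<Rightarrow> ?g i j) = 0"
          using conc_power_eq_0[of C, OF C0] by auto
      qed
    qed auto
    also have "\<dots> = exp_series \<iota> C u * exp_series \<iota> C v"
      by (simp add: exp_series_def sum_product sum.cartesian_product)
    finally show ?thesis .
  qed
  then show ?thesis using alg by (simp add: grouplike_alt)
qed

text \<open>Apart from the linear term, the coefficient of \<open>e\<^sup>C\<close> at \<open>w\<close> depends only on the coefficients
  of \<open>C\<close> at words shorter than \<open>w\<close>. This makes \<open>C\<close> computable from \<open>e\<^sup>C\<close> by recursion, and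
  properties of \<open>C\<close> provable by cutting \<open>C\<close> off at a given length.\<close>

lemma conc_power_agree:
  assumes C: "\<And>v. length v < N \<Longrightarrow> C v = C' v" and w: "length w < N"
  shows "conc_power C n w = conc_power C' n w"
  using w
proof (induction n arbitrary: w)
  case (Suc n)
  then show ?case by (auto intro!: conc_cong C)
qed simp

lemma exp_series_agree:
  assumes "\<And>v. length v < N \<Longrightarrow> C v = C' v" "length w < N"
  shows "exp_series \<iota> C w = exp_series \<iota> C' w"
  unfolding exp_series_def using conc_power_agree[OF assms] by simp

lemma exp_series_agree_nonlinear:
  assumes alg: "complex_algebra \<iota>" and C0: "C [] = 0" "C' [] = 0"
    and C: "\<And>v. length v < N \<Longrightarrow> C v = C' v" and w: "length w = N"
  shows "exp_series \<iota> C w - C w = exp_series \<iota> C' w - C' w"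
proof -
  have pow: "conc_power C n w - conc_power C' n w = (if n = 1 then C w - C' w else 0)" for n
  proof -
    consider "n = 0" | "n = 1" | m where "n = Suc (Suc m)"
      by (metis One_nat_def not0_implies_Suc)
    then show ?thesis
    proof cases
      case 3
      have "C (take i w) * conc_power C (Suc m) (drop i w) =
          C' (take i w) * conc_power C' (Suc m) (drop i w)" if i: "i \<le> N" for i
      proof -
        consider "i = 0" | "i = N" | "0 < i" "i < N" using i by linarith
        then show ?thesis
        proof cases
          case 3
          have "conc_power C (Suc m) (drop i w) = conc_power C' (Suc m) (drop i w)"
            by (rule conc_power_agree[OF C]) (use 3 w in auto)
          then show ?thesis using C[of "take i w"] 3 w by simp
        qed (use C0 w in auto)
      qed
      then have "conc C (conc_power C (Suc m)) w = conc C' (conc_power C' (Suc m)) w"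
        unfolding conc_def[of C "conc_power C (Suc m)"] conc_def[of C' "conc_power C' (Suc m)"]
        using w by simp
      then show ?thesis using 3 by simp
    qed auto
  qed
  show ?thesis
  proof (cases "w = []")
    case True
    then show ?thesis using C0 alg by simp
  next
    case False
    have "exp_series \<iota> C w - exp_series \<iota> C' w =
        (\<Sum>n\<le>length w. \<iota> (1 / fact n) * (conc_power C n w - conc_power C' n w))"
      by (simp add: exp_series_def algebra_simps sum_subtractf)
    also have "\<dots> = (\<Sum>n\<le>length w. if n = 1 then C w - C' w else 0)"
      unfolding pow by (rule sum.cong) (use alg in \<open>auto simp: complex_algebra_def\<close>)
    also have "\<dots> = C w - C' w" using False by (simp add: Suc_le_eq)
    finally show ?thesis by (simp add: algebra_simps)
  qed
qed

text \<open>The logarithm of \<open>G\<close>, determined for one length after the other; the values at words of length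
  at least \<open>N\<close> are \<open>0\<close>.\<close>

primrec log_upto :: "(complex \<Rightarrow> 'a) \<Rightarrow> ('x, 'a::comm_ring_1) series \<Rightarrow> nat \<Rightarrow> ('x, 'a) series" where
  "log_upto \<iota> G 0 = (\<lambda>_. 0)"
| "log_upto \<iota> G (Suc N) = (\<lambda>w. if length w = N \<and> w \<noteq> []
     then G w - exp_series \<iota> (log_upto \<iota> G N) w else log_upto \<iota> G N w)"

lemma exp_series_surj:
  assumes alg: "complex_algebra \<iota>" and G: "G [] = 1"
  obtains C where "C [] = 0" "exp_series \<iota> C = G"
proof
  let ?L = "log_upto \<iota> G"
  define C where "C w = ?L (Suc (length w)) w" for w
  have zero: "?L N w = 0" if "N \<le> length w" for N w
    using that by (induction N) auto
  have Nil: "?L N [] = 0" for N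
    by (induction N) auto
  have agree: "?L N w = ?L M w" if "length w < M" "M \<le> N" for M N w
    using that(2) by (induction N rule: dec_induct) (use that(1) in auto)
  show C0: "C [] = 0" by (simp add: C_def Nil)
  show "exp_series \<iota> C = G"
  proof
    fix w
    show "exp_series \<iota> C w = G w"
    proof (cases "w = []")
      case True
      then show ?thesis using alg G by simp
    next
      case False
      let ?N = "length w"
      have "exp_series \<iota> C w - C w = exp_series \<iota> (?L ?N) w - ?L ?N w"
      proof (rule exp_series_agree_nonlinear[where C = C and C' = "?L ?N" and N = ?N, OF alg C0 Nil])
        show "C v = ?L ?N v" if "length v < ?N" for v
          unfolding C_def by (rule agree[symmetric]) (use that in auto)
      qed simp
      moreover have "C w = G w - exp_series \<iota> (?L ?N) w"
        using False by (simp add: C_def)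
      ultimately show ?thesis by (simp add: zero)
    qed
  qed
qed

text \<open>Let \<open>C'\<close> be \<open>C\<close> cut off below length \<open>N = |u| + |v|\<close>. By induction it is primitive, so
  \<open>e\<^bsup>C'\<^esup>\<close> is grouplike; since \<open>e\<^sup>C\<close> and \<open>e\<^bsup>C'\<^esup> + C\<close> agree at the words of length \<open>N\<close>,
  the defect \<open>\<langle>C | u \<squnion>\<squnion> v\<rangle>\<close> of \<open>C\<close> is that of \<open>e\<^sup>C\<close>.\<close>

lemma primitive_if_grouplike_exp:
  fixes C :: "('x, 'a::comm_ring_1) series"
  assumes alg: "complex_algebra \<iota>" and C0: "C [] = 0" and E: "grouplike (exp_series \<iota> C)"
  shows "primitive C"
proof -
  have "coproduct C u v = 0" if "u \<noteq> []" "v \<noteq> []" for u v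
    using that
  proof (induction "length u + length v" arbitrary: u v rule: less_induct)
    case less
    define N where "N = length u + length v"
    define C' where "C' w = (if length w < N then C w else 0)" for w
    have C'0: "C' [] = 0" using C0 by (simp add: C'_def)
    have len: "length w = length a + length b" if "mset w = mset a + mset b" for w a b :: "'x list"
      using that by (metis size_mset size_union)
    have "primitive C'"
      unfolding primitive_def
    proof (intro conjI allI impI C'0)
      fix a b :: "'x list" assume ab: "a \<noteq> [] \<and> b \<noteq> []"
      show "coproduct C' a b = 0"
      proof (cases "length a + length b < N")
        case True
        have "coproduct C' a b = coproduct C a b"
          by (rule coproduct_cong) (use True in \<open>auto simp: C'_def dest!: len\<close>)
        then show ?thesis using less(1)[of a b] ab True by (simp add: N_def)
      next
        case False
        have "coproduct C' a b = coproduct (\<lambda>_. 0) a b"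
          by (rule coproduct_cong) (use False in \<open>auto simp: C'_def dest!: len\<close>)
        then show ?thesis by (simp add: coproduct_def)
      qed
    qed
    then have E': "grouplike (exp_series \<iota> C')"
      by (rule grouplike_exp_series[OF alg])
    have "coproduct (exp_series \<iota> C) u v = coproduct (\<lambda>w. exp_series \<iota> C' w + C w) u v"
    proof (rule coproduct_cong)
      fix w assume "mset w = mset u + mset v"
      then have w: "length w = N" by (simp add: N_def len)
      have "exp_series \<iota> C w - C w = exp_series \<iota> C' w - C' w"
        by (rule exp_series_agree_nonlinear[where C = C and C' = C' and N = N, OF alg C0 C'0]) (simp_all add: C'_def w)
      then show "exp_series \<iota> C w = exp_series \<iota> C' w + C w"
        using w by (simp add: C'_def algebra_simps)
    qed
    moreover have "exp_series \<iota> C u = exp_series \<iota> C' u" "exp_series \<iota> C v = exp_series \<iota> C' v"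
      by (rule exp_series_agree[of N]; use less.prems in \<open>simp add: C'_def N_def\<close>)+
    ultimately show ?case
      by (simp add: coproduct_add grouplike_coproduct[OF E] grouplike_coproduct[OF E'])
  qed
  then show ?thesis using C0 by (simp add: primitive_def)
qed

theorem grouplike_imp_exp_lie:
  assumes alg: "complex_algebra \<iota>" and G: "grouplike G"
  obtains C where "C \<in> lie_series" "G = exp_series \<iota> C"
proof -
  obtain C where C: "C [] = 0" "exp_series \<iota> C = G"
    using exp_series_surj[of \<iota> G] alg grouplike_Nil[OF G] by blast
  then have "primitive C" using primitive_if_grouplike_exp[OF alg] G by blast
  then show ?thesis using that C primitive_imp_lie[OF alg] by blast
qed

section \<open>Grouplike solutions of the differential equation\<close>

lemma deriv_series_conc:
  assumes "derivation \<delta>"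
  shows "deriv_series \<delta> (conc S T) = (\<lambda>w. conc (deriv_series \<delta> S) T w + conc S (deriv_series \<delta> T) w)"
  by (simp add: deriv_series_def conc_def derivation_sum[OF assms] derivation_mult[OF assms] sum.distrib)

lemma deriv_series_exp_0:
  assumes der: "derivation \<delta>" and const: "\<And>z. \<delta> (\<iota> z) = 0"
    and C: "deriv_series \<delta> C = (\<lambda>_. 0)"
  shows "deriv_series \<delta> (exp_series \<iota> C) = (\<lambda>_. 0)"
proof -
  have "deriv_series \<delta> (conc_power C n) = (\<lambda>_. 0)" for n
  proof (induction n)
    case 0
    then show ?case by (auto simp: deriv_series_def word_def derivation_0[OF der] derivation_1[OF der])
  next
    case (Suc n)
    then show ?case using C by (simp add: deriv_series_conc[OF der])
  qed
  then show ?thesis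
    by (simp add: exp_series_def deriv_series_def derivation_sum[OF der] derivation_mult[OF der] const
        fun_eq_iff)
qed

text \<open>By induction on the length of \<open>w\<close>: up to the linear term \<open>\<langle>C | w\<rangle>\<close>, the coefficient
  \<open>\<langle>e\<^sup>C | w\<rangle>\<close> is one of the exponential of a constant series.\<close>

lemma deriv_series_exp_0D:
  assumes alg: "complex_algebra \<iota>" and der: "derivation \<delta>" and const: "\<And>z. \<delta> (\<iota> z) = 0"
    and C0: "C [] = 0" and E: "deriv_series \<delta> (exp_series \<iota> C) = (\<lambda>_. 0)"
  shows "deriv_series \<delta> C = (\<lambda>_. 0)"
proof -
  have "\<delta> (C w) = 0" for w
  proof (induction "length w" arbitrary: w rule: less_induct)
    case less
    define C' where "C' v = (if length v < length w then C v else 0)" for v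
    have "deriv_series \<delta> C' = (\<lambda>_. 0)"
      using less by (auto simp: deriv_series_def C'_def derivation_0[OF der])
    then have "\<delta> (exp_series \<iota> C' w) = 0"
      using deriv_series_exp_0[of \<delta> \<iota> C', OF der const] by (simp add: deriv_series_def fun_eq_iff)
    moreover have "exp_series \<iota> C w - C w = exp_series \<iota> C' w - C' w"
      by (rule exp_series_agree_nonlinear[where C = C and C' = C' and N = "length w", OF alg C0]) (simp_all add: C'_def C0)
    then have "C w = exp_series \<iota> C w - exp_series \<iota> C' w"
      by (simp add: C'_def algebra_simps)
    moreover have "\<delta> (exp_series \<iota> C w) = 0"
      using E by (simp add: deriv_series_def fun_eq_iff)
    ultimately show ?case by (simp add: derivation_diff[OF der])
  qed
  then show ?thesis by (simp add: deriv_series_def)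
qed

text \<open>Grouplike series form a group, so \<open>H\<^sup>-\<^sup>1 S\<close> is grouplike and hence the exponential of a Lie
  series.\<close>

lemma grouplike_quotient_exp_lie:
  assumes alg: "complex_algebra \<iota>" and S: "grouplike S" and H: "grouplike H"
  obtains C where "C \<in> lie_series" "S = conc H (exp_series \<iota> C)"
proof -
  define H' where "H' = (\<lambda>w. (- 1) ^ length w * H (rev w))"
  have HH': "conc H H' = word []"
    unfolding H'_def by (rule grouplike_inverse[OF H])
  have "conc H (\<lambda>w. conc H' H w - word [] w) = (\<lambda>w. conc (conc H H') H w - H w)"
    using conc_add_right[of H "conc H' H" "\<lambda>w. - 1 * word [] w"]
    by (simp only: conc_scale_right) (simp add: conc_assoc)
  then have "(\<lambda>w. conc H' H w - word [] w) = (\<lambda>_. 0)"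
    by - (rule conc_cancel_left[of H], simp_all add: HH' grouplike_Nil[OF H])
  then have "conc H' H = word []" by (simp add: fun_eq_iff)
  moreover have "grouplike (word [])"
    by (simp add: grouplike_alt coproduct_word_Nil)
  ultimately have "grouplike H'"
    using grouplike_quotient_right[of H' H] H by simp
  then have "grouplike (conc H' S)" using S by (rule grouplike_conc)
  then obtain C where C: "C \<in> lie_series" "conc H' S = exp_series \<iota> C"
    using grouplike_imp_exp_lie[OF alg] by blast
  have "conc H (exp_series \<iota> C) = S"
    unfolding C(2)[symmetric] conc_assoc[symmetric] HH' by simp
  then show ?thesis using that C by blast
qed

text \<open>The product rule reads \<open>M H e\<^sup>C = (\<partial>H) e\<^sup>C + H \<partial>(e\<^sup>C)\<close>, where \<open>H\<close> and \<open>e\<^sup>C\<close> are cancellable.\<close>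

lemma solution_iff_constant:
  assumes alg: "complex_algebra \<iota>" and der: "derivation \<delta>" and const: "\<And>z. \<delta> (\<iota> z) = 0"
    and sol: "solution \<delta> M S" and C: "C \<in> lie_series" and S: "S = conc H (exp_series \<iota> C)"
  shows "solution \<delta> M H \<longleftrightarrow> deriv_series \<delta> C = (\<lambda>_. 0)"
proof -
  let ?E = "exp_series \<iota> C"
  have C0: "C [] = 0" using C by (simp add: lie_series_def)
  have E0: "?E [] = 1" using alg by simp
  have H0: "H [] = 1" using sol S E0 by (simp add: solution_def)
  have eq: "conc (deriv_series \<delta> H) ?E w + conc H (deriv_series \<delta> ?E) w = conc (conc M H) ?E w" for w
    using sol unfolding solution_def S deriv_series_conc[OF der] conc_assoc by (simp add: fun_eq_iff)
  show ?thesis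
  proof
    assume "solution \<delta> M H"
    then have "conc H (deriv_series \<delta> ?E) w = 0" for w
      using eq[of w] by (simp add: solution_def)
    then have "deriv_series \<delta> ?E = (\<lambda>_. 0)"
      by - (rule conc_cancel_left[of H], auto simp: H0)
    then show "deriv_series \<delta> C = (\<lambda>_. 0)"
      by (rule deriv_series_exp_0D[of \<iota> \<delta> C, OF alg der const C0])
  next
    assume "deriv_series \<delta> C = (\<lambda>_. 0)"
    then have "deriv_series \<delta> ?E = (\<lambda>_. 0)"
      by (rule deriv_series_exp_0[of \<delta> \<iota> C, OF der const])
    then have "conc (deriv_series \<delta> H) ?E = conc (conc M H) ?E"
      using eq by auto
    then have "conc (\<lambda>w. deriv_series \<delta> H w - conc M H w) ?E = (\<lambda>_. 0)"
      by (simp add: conc_diff_left)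
    then have "(\<lambda>w. deriv_series \<delta> H w - conc M H w) = (\<lambda>_. 0)"
      by (rule conc_cancel_right[of ?E, OF E0])
    then show "solution \<delta> M H" using H0 by (simp add: solution_def fun_eq_iff)
  qed
qed

section \<open>Radford's theorem\<close>

text \<open>Two words \<open>c @ t @ s\<close> and \<open>c @ t @ w\<close> are merged, and \<open>c\<close> has been read from the first and \<open>c @ t\<close>
  from the second, so that \<open>t @ s\<close> and \<open>w\<close> remain. Reading \<open>c @ t\<close> from the first and \<open>c\<close> from the
  second gives the same letters and leaves \<open>s\<close> and \<open>t @ w\<close>; as \<open>w \<le> s\<close>, this is at least as good
  for a large result.\<close>

lemma shuffles_exchange:
  fixes s :: "'x::linorder list"
  assumes "w \<le> s" "v \<in> shuffles (t @ s) w"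
  shows "\<exists>v'\<in>shuffles s (t @ w). v \<le> v'"
  using assms
proof (induction v arbitrary: t s w)
  case Nil
  then show ?case by auto
next
  case (Cons z v)
  show ?case
  proof (cases t)
    case Nil
    then show ?thesis using Cons.prems by auto
  next
    case t: (Cons x t')
    from Cons.prems(2) consider "x = z" "v \<in> shuffles (t' @ s) w"
      | w' where "w = z # w'" "v \<in> shuffles (t @ s) w'"
      unfolding Cons_in_shuffles_iff t by (cases w) auto
    then show ?thesis
    proof cases
      case 1
      from Cons.IH[OF Cons.prems(1) 1(2)] obtain v' where "v' \<in> shuffles s (t' @ w)" "v \<le> v'" by blast
      then show ?thesis using 1 t
        by (intro bexI[of _ "z # v'"]) (auto intro: Cons_in_shuffles_rightI)
    next
      case 2
      with Cons.prems(1) obtain y s' where s: "s = y # s'" "z < y \<or> z = y \<and> w' \<le> s'"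
        by (cases s) auto
      show ?thesis
      proof (cases "z < y")
        case True
        have "splice s' (t @ w) \<in> shuffles s' (t @ w)" by simp
        then have "y # splice s' (t @ w) \<in> shuffles s (t @ w)"
          using s by (auto intro: Cons_in_shuffles_leftI)
        then show ?thesis using True by (intro bexI[of _ "y # splice s' (t @ w)"]) auto
      next
        case False
        with s 2 Cons.IH[of w' s' "t @ [z]"]
        obtain v' where "v' \<in> shuffles s' (t @ w)" "v \<le> v'" by auto
        then show ?thesis using s False
          by (intro bexI[of _ "y # v'"]) (auto intro: Cons_in_shuffles_leftI)
      qed
    qed
  qed
qed

text \<open>The greedy merge always reads from the greater word; if no nonempty suffix of \<open>s\<close> is less
  than \<open>m\<close>, it reads all of \<open>s\<close> before \<open>m\<close>.\<close>

lemma shuffles_le_append: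
  fixes s m :: "'x::linorder list"
  assumes "\<And>p q. s = p @ q \<Longrightarrow> q \<noteq> [] \<Longrightarrow> m \<le> q" "v \<in> shuffles s m"
  shows "v \<le> s @ m"
  using assms
proof (induction s arbitrary: v)
  case Nil
  then show ?case by simp
next
  case (Cons x s)
  have IH: "v' \<le> s @ m" if "v' \<in> shuffles s m" for v'
    by (rule Cons.IH[OF _ that]) (use Cons.prems(1)[of "x # _"] in auto)
  have m: "m \<le> x # s" using Cons.prems(1)[of "[]" "x # s"] by simp
  obtain z v' where v: "v = z # v'" using Cons.prems(2) by (cases v) auto
  from Cons.prems(2) consider "z = x" "v' \<in> shuffles s m"
    | m' where "m = z # m'" "v' \<in> shuffles (x # s) m'"
    unfolding Cons_in_shuffles_iff v by (cases m) auto
  then show ?case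
  proof cases
    case 1
    then show ?thesis using IH v by simp
  next
    case 2
    then consider "z < x" | "z = x" "m' \<le> s" using m by auto
    then show ?thesis
    proof cases
      case 1
      then show ?thesis using v by simp
    next
      case z: 2
      have "v' \<in> shuffles ([x] @ s) m'" using 2 by simp
      from shuffles_exchange[OF z(2) this] obtain v'' where
        "v'' \<in> shuffles s m" "v' \<le> v''" using 2 z by auto
      then show ?thesis using IH[of v''] v z by auto
    qed
  qed
qed

text \<open>Shuffling in the same pattern preserves the order of words of equal length.\<close>

lemma shuffles_mono:
  fixes w :: "'x::linorder list"
  assumes "w' \<le> w" "length w' = length w" "v \<in> shuffles w' m"
  shows "\<exists>v2\<in>shuffles w m. v \<le> v2"
  using assms
proof (induction v arbitrary: w w' m)
  case Nil
  then show ?case by auto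
next
  case (Cons z v)
  from Cons.prems(3) consider w1' where "w' = z # w1'" "v \<in> shuffles w1' m"
    | m' where "m = z # m'" "v \<in> shuffles w' m'"
    unfolding Cons_in_shuffles_iff by (cases m; cases w') auto
  then show ?case
  proof cases
    case 1
    with Cons.prems obtain x w1 where w: "w = x # w1" "length w1' = length w1"
      "z < x \<or> z = x \<and> w1' \<le> w1"
      by (cases w) auto
    show ?thesis
    proof (cases "z < x")
      case True
      have "x # splice w1 m \<in> shuffles w m"
        using w by (auto intro: Cons_in_shuffles_leftI)
      then show ?thesis using True by (intro bexI[of _ "x # splice w1 m"]) auto
    next
      case False
      with w Cons.IH[of w1' w1 m] 1 obtain v2 where "v2 \<in> shuffles w1 m" "v \<le> v2" by auto
      then show ?thesis using False w
        by (intro bexI[of _ "z # v2"]) (auto intro: Cons_in_shuffles_leftI)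
    qed
  next
    case 2
    with Cons.IH[of w' w m'] Cons.prems obtain v2 where "v2 \<in> shuffles w m'" "v \<le> v2" by auto
    then show ?thesis using 2
      by (intro bexI[of _ "z # v2"]) (auto intro: Cons_in_shuffles_rightI)
  qed
qed

lemma lyndon_le_suffix: "lyndon l \<Longrightarrow> l = p @ q \<Longrightarrow> q \<noteq> [] \<Longrightarrow> l \<le> q"
  by (cases "p = []") (auto simp: lyndon_def intro: less_imp_le)

text \<open>A suffix of the concatenation starts with a suffix of one of the Lyndon words, and this is at least
  that Lyndon word.\<close>

lemma lyndon_concat_suffix:
  assumes "\<forall>l\<in>set ls. lyndon l \<and> m \<le> l" "concat ls = p @ q" "q \<noteq> []"
  shows "m \<le> q"
  using assms
proof (induction ls arbitrary: p)
  case Nil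
  then show ?case by simp
next
  case (Cons l ls)
  from Cons.prems(2) consider p' where "p = l @ p'" "concat ls = p' @ q"
    | r where "l = p @ r" "q = r @ concat ls" "r \<noteq> []"
    by (auto simp: append_eq_append_conv2) (metis append_Nil append_Nil2)+
  then show ?case
  proof cases
    case 1
    then show ?thesis using Cons.IH Cons.prems by auto
  next
    case 2
    have "m \<le> l" using Cons.prems(1) by simp
    also have "l \<le> r" using lyndon_le_suffix[of l p r] 2 Cons.prems(1) by simp
    also have "r \<le> q" using 2 le_append by blast
    finally show ?thesis .
  qed
qed

definition shuffle_all :: "'x list list \<Rightarrow> 'x list list" where
  "shuffle_all ls = foldl (\<lambda>W m. concat (map (\<lambda>w. shuffle_list w m) W)) [[]] ls"

lemma shuffle_all_Nil [simp]: "shuffle_all [] = [[]]"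
  and shuffle_all_snoc: "shuffle_all (ls @ [m]) = concat (map (\<lambda>w. shuffle_list w m) (shuffle_all ls))"
  by (simp_all add: shuffle_all_def)

lemma mset_shuffle_all: "w \<in> set (shuffle_all ls) \<Longrightarrow> mset w = mset (concat ls)"
  by (induction ls arbitrary: w rule: rev_induct)
    (auto simp: shuffle_all_snoc set_shuffle_list dest!: mset_shuffles)

lemma append_in_shuffles: "u @ v \<in> shuffles u v"
  by (induction u) (auto intro: Cons_in_shuffles_leftI)

lemma concat_in_shuffle_all: "concat ls \<in> set (shuffle_all ls)"
  by (induction ls rule: rev_induct) (auto simp: shuffle_all_snoc set_shuffle_list intro: append_in_shuffles)

text \<open>A shuffle of Lyndon words is at most their nonincreasing concatenation. The words are added in
  nonincreasing order, so that every nonempty suffix of what is there is at least the word to come.\<close>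

lemma shuffle_all_le:
  fixes ls :: "'x::linorder list list"
  assumes "\<forall>l\<in>set ls. lyndon l" "sorted_wrt (\<ge>) ls" "v \<in> set (shuffle_all ls)"
  shows "v \<le> concat ls"
  using assms
proof (induction ls arbitrary: v rule: rev_induct)
  case Nil
  then show ?case by simp
next
  case (snoc m ls)
  from snoc.prems(3) obtain w' where w': "w' \<in> set (shuffle_all ls)" "v \<in> shuffles w' m"
    by (auto simp: shuffle_all_snoc set_shuffle_list)
  have "w' \<le> concat ls"
    using snoc.IH[OF _ _ w'(1)] snoc.prems by (auto simp: sorted_wrt_append)
  moreover have "length w' = length (concat ls)"
    using mset_shuffle_all[OF w'(1)] by (metis size_mset)
  ultimately obtain v2 where v2: "v2 \<in> shuffles (concat ls) m" "v \<le> v2"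
    using shuffles_mono w'(2) by blast
  have "v2 \<le> concat ls @ m"
  proof (rule shuffles_le_append[OF _ v2(1)])
    fix p q assume "concat ls = p @ q" "q \<noteq> []"
    then show "m \<le> q"
      by (rule lyndon_concat_suffix[rotated]) (use snoc.prems in \<open>auto simp: sorted_wrt_append\<close>)
  qed
  then show ?case using v2(2) by simp
qed

lemma grouplike_shuffle_all:
  assumes "grouplike S"
  shows "(\<Sum>w\<leftarrow>shuffle_all ls. S w) = (\<Prod>l\<leftarrow>ls. S l)"
proof (induction ls rule: rev_induct)
  case Nil
  then show ?case using assms by (simp add: grouplike_alt)
next
  case (snoc m ls)
  have "(\<Sum>w\<leftarrow>concat (map (\<lambda>w. shuffle_list w m) W). S w) = (\<Sum>w\<leftarrow>W. S w) * S m" for W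
    using grouplike_coproduct[OF assms]
    by (induction W) (simp_all add: coproduct_def distrib_right)
  then show ?case using snoc by (simp add: shuffle_all_snoc)
qed

text \<open>Hence the product of the \<open>\<langle>S | l\<rangle>\<close> over the Lyndon factors \<open>l\<close> of \<open>w\<close> is a positive integer
  multiple of \<open>\<langle>S | w\<rangle>\<close> plus terms \<open>\<langle>S | v\<rangle>\<close> with \<open>v < w\<close> of the same multidegree.\<close>

definition lyndon_coeff :: "'x::linorder list \<Rightarrow> 'x list \<Rightarrow> nat" where
  "lyndon_coeff w v = count_list (shuffle_all (lyndon_fact w)) v"

lemma lyndon_coeff_diag: "lyndon_coeff w w > 0"
  using concat_in_shuffle_all[of "lyndon_fact w"] is_lyndon_fact_lyndon_fact[of w]
  by (auto simp: lyndon_coeff_def is_lyndon_fact_def count_list_0_iff intro!: gr0I)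

lemma shuffle_lyndon_fact:
  fixes w :: "'x::linorder list"
  shows "set (shuffle_all (lyndon_fact w)) \<subseteq> {v \<in> words_of (mset w). v \<le> w}"
proof
  fix v assume v: "v \<in> set (shuffle_all (lyndon_fact w))"
  have f: "is_lyndon_fact w (lyndon_fact w)" by (rule is_lyndon_fact_lyndon_fact)
  have "mset v = mset w" using mset_shuffle_all[OF v] f by (simp add: is_lyndon_fact_def)
  moreover have "v \<le> w"
    using shuffle_all_le[of "lyndon_fact w", OF _ _ v] f by (auto simp: is_lyndon_fact_def)
  ultimately show "v \<in> {v \<in> words_of (mset w). v \<le> w}" by simp
qed

lemma prod_lyndon_fact:
  fixes S :: "('x::linorder, 'a::comm_ring_1) series"
  assumes "grouplike S"
  shows "(\<Prod>l\<leftarrow>lyndon_fact w. S l) =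
    (\<Sum>v\<in>{v \<in> words_of (mset w). v \<le> w}. of_nat (lyndon_coeff w v) * S v)"
  unfolding grouplike_shuffle_all[OF assms, symmetric] lyndon_coeff_def
  by (subst sum_list_eq_sum_count_list[OF _ shuffle_lyndon_fact])
    (auto simp: finite_words_of mult.commute)

section \<open>Linear and algebraic independence over a subring\<close>

lemma lin_indep_alt:
  fixes a :: "'i \<Rightarrow> 'a::comm_ring_1"
  assumes "0 \<in> C"
  shows "lin_indep C I a \<longleftrightarrow>
    (\<forall>F c. finite F \<and> F \<subseteq> I \<and> (\<forall>i\<in>F. c i \<in> C) \<and> (\<Sum>i\<in>F. c i * a i) = 0 \<longrightarrow> (\<forall>i\<in>F. c i = 0))"
    (is "_ \<longleftrightarrow> ?R")
proof
  assume L: "lin_indep C I a"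
  show ?R
  proof (intro allI impI)
    fix F and c :: "'i \<Rightarrow> 'a"
    assume A: "finite F \<and> F \<subseteq> I \<and> (\<forall>i\<in>F. c i \<in> C) \<and> (\<Sum>i\<in>F. c i * a i) = 0"
    define f where "f i = (if i \<in> F then c i else 0)" for i
    have fin: "finite {i. f i \<noteq> 0}" using A by (auto simp: f_def intro: finite_subset)
    define p where "p = Abs_poly_mapping f"
    have lk: "Poly_Mapping.lookup p = f" using fin by (simp add: p_def)
    have keys: "Poly_Mapping.keys p = {i\<in>F. c i \<noteq> 0}"
      by (auto simp: in_keys_iff lk f_def split: if_splits)
    have "(\<Sum>i\<in>Poly_Mapping.keys p. Poly_Mapping.lookup p i * a i) = (\<Sum>i\<in>F. c i * a i)"
      unfolding keys lk by (rule sum.mono_neutral_cong_left) (use A in \<open>auto simp: f_def\<close>)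
    moreover have "Poly_Mapping.keys p \<subseteq> I" using A keys by auto
    moreover have "\<forall>i. Poly_Mapping.lookup p i \<in> C" using A assms by (auto simp: lk f_def)
    ultimately have "p = 0" using L A unfolding lin_indep_def by auto
    then have "f i = 0" for i using lk by (metis lookup_zero)
    then show "\<forall>i\<in>F. c i = 0" unfolding f_def by metis
  qed
next
  assume R: ?R
  show "lin_indep C I a"
    unfolding lin_indep_def
  proof (intro allI impI)
    fix c :: "'i \<Rightarrow>\<^sub>0 'a"
    assume A: "Poly_Mapping.keys c \<subseteq> I \<and> (\<forall>i. Poly_Mapping.lookup c i \<in> C) \<and>
      (\<Sum>i\<in>Poly_Mapping.keys c. Poly_Mapping.lookup c i * a i) = 0"
    have "Poly_Mapping.lookup c i = 0" if "i \<in> Poly_Mapping.keys c" for i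
      by (rule R[rule_format, of "Poly_Mapping.keys c"]) (use A that in auto)
    then have "Poly_Mapping.keys c = {}" unfolding in_keys_iff by blast
    then show "c = 0" by simp
  qed
qed

lemma lin_indepD:
  assumes "lin_indep C I a" "0 \<in> C" "finite F" "F \<subseteq> I" "\<And>i. i \<in> F \<Longrightarrow> c i \<in> C"
    "(\<Sum>i\<in>F. c i * a i) = 0" "i \<in> F"
  shows "c i = 0"
  using assms unfolding lin_indep_alt[OF assms(2)] by blast

lemma lin_indep_reindex:
  assumes C: "0 \<in> C" and f: "bij_betw f I J"
  shows "lin_indep C J a \<longleftrightarrow> lin_indep C I (\<lambda>i. a (f i))"
proof
  assume L: "lin_indep C J a"
  show "lin_indep C I (\<lambda>i. a (f i))"
    unfolding lin_indep_alt[OF C]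
  proof (intro allI impI ballI)
    fix F c i
    assume A: "finite F \<and> F \<subseteq> I \<and> (\<forall>i\<in>F. c i \<in> C) \<and> (\<Sum>i\<in>F. c i * a (f i)) = 0" and i: "i \<in> F"
    have inj: "inj_on f F" using A f by (meson bij_betw_def inj_on_subset)
    let ?g = "the_inv_into F f"
    have "c (?g (f i)) = 0"
    proof (rule lin_indepD[OF L C, of "f ` F" "\<lambda>j. c (?g j)"])
      show "(\<Sum>j\<in>f ` F. c (?g j) * a j) = 0"
        using A by (simp add: sum.reindex[OF inj] the_inv_into_f_f[OF inj])
    qed (use A i f in \<open>auto simp: the_inv_into_f_f[OF inj] bij_betw_def\<close>)
    then show "c i = 0" using i by (simp add: the_inv_into_f_f[OF inj])
  qed
next
  assume L: "lin_indep C I (\<lambda>i. a (f i))"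
  show "lin_indep C J a"
    unfolding lin_indep_alt[OF C]
  proof (intro allI impI ballI)
    fix F c j
    assume A: "finite F \<and> F \<subseteq> J \<and> (\<forall>i\<in>F. c i \<in> C) \<and> (\<Sum>i\<in>F. c i * a i) = 0" and j: "j \<in> F"
    let ?g = "the_inv_into I f"
    have inj: "inj_on f I" and img: "f ` I = J" using f by (auto simp: bij_betw_def)
    have fg: "f (?g i) = i" if "i \<in> F" for i
      using that A img by (intro f_the_inv_into_f[OF inj]) auto
    have gI: "?g i \<in> I" if "i \<in> F" for i
      using that A img by (intro the_inv_into_into[OF inj]) auto
    have injg: "inj_on ?g F" using fg by (metis inj_onI)
    have "c (f (?g j)) = 0"
    proof (rule lin_indepD[OF L C, of "?g ` F" "\<lambda>i. c (f i)"])
      show "(\<Sum>i\<in>?g ` F. c (f i) * a (f i)) = 0"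
        using A by (simp add: sum.reindex[OF injg] fg cong: sum.cong)
    qed (use A j gI in \<open>auto simp: fg\<close>)
    then show "c j = 0" using j by (simp add: fg)
  qed
qed

lemma lin_indep_mono:
  assumes "lin_indep C J a" "I \<subseteq> J"
  shows "lin_indep C I a"
  using assms unfolding lin_indep_def by blast

lemma lin_indep_cong:
  assumes "lin_indep C I a" "\<And>i. i \<in> I \<Longrightarrow> a i = b i"
  shows "lin_indep C I b"
  unfolding lin_indep_def
proof (intro allI impI)
  fix c
  assume c: "Poly_Mapping.keys c \<subseteq> I \<and> (\<forall>i. Poly_Mapping.lookup c i \<in> C) \<and>
    (\<Sum>i\<in>Poly_Mapping.keys c. Poly_Mapping.lookup c i * b i) = 0"
  then have "(\<Sum>i\<in>Poly_Mapping.keys c. Poly_Mapping.lookup c i * a i) = 0"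
    using assms(2) by (simp add: subset_iff)
  then show "c = 0" using assms(1) c unfolding lin_indep_def by blast
qed

text \<open>An algebraic relation is a linear relation between monomials.\<close>

definition monomial :: "('i \<Rightarrow> 'a::comm_ring_1) \<Rightarrow> ('i \<Rightarrow>\<^sub>0 nat) \<Rightarrow> 'a" where
  "monomial a m = (\<Prod>i\<in>Poly_Mapping.keys m. a i ^ Poly_Mapping.lookup m i)"

lemma alg_indep_alt: "alg_indep C I a \<longleftrightarrow> lin_indep C {m. Poly_Mapping.keys m \<subseteq> I} (monomial a)"
  unfolding alg_indep_def lin_indep_def mpoly_eval_def monomial_def by auto

text \<open>A family that is triangular over an independent one, with nonzero diagonal, is independent:
  look at the greatest index of a relation.\<close>

lemma lin_indep_triangular:
  fixes a b :: "'i::linorder \<Rightarrow> 'a::idom"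
  assumes C0: "0 \<in> C" and Cadd: "\<And>x y. x \<in> C \<Longrightarrow> y \<in> C \<Longrightarrow> x + y \<in> C"
    and Cmult: "\<And>x y. x \<in> C \<Longrightarrow> y \<in> C \<Longrightarrow> x * y \<in> C"
    and fin: "\<And>i. finite (D i)" and le: "\<And>i j. j \<in> D i \<Longrightarrow> j \<le> i"
    and diag: "\<And>i. i \<in> D i" "\<And>i. T i i \<noteq> 0" and T: "\<And>i j. T i j \<in> C"
    and b: "\<And>i. b i = (\<Sum>j\<in>D i. T i j * a j)"
    and indep: "lin_indep C UNIV a"
  shows "lin_indep C UNIV b"
  unfolding lin_indep_alt[OF C0]
proof (intro allI impI)
  fix F c
  assume A: "finite F \<and> F \<subseteq> UNIV \<and> (\<forall>i\<in>F. c i \<in> C) \<and> (\<Sum>i\<in>F. c i * b i) = 0"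
  show "\<forall>i\<in>F. c i = 0"
  proof (rule ccontr)
    assume "\<not> ?thesis"
    then have ne: "{i\<in>F. c i \<noteq> 0} \<noteq> {}" by auto
    have finF: "finite {i\<in>F. c i \<noteq> 0}" using A by simp
    define k where "k = Max {i\<in>F. c i \<noteq> 0}"
    have k: "k \<in> F" "c k \<noteq> 0" using Max_in[OF finF ne] by (auto simp: k_def)
    have kmax: "i \<le> k" if "i \<in> F" "c i \<noteq> 0" for i
      using Max_ge[OF finF] that by (auto simp: k_def)
    define G where "G = (\<Union>i\<in>F. D i)"
    define e where "e j = (\<Sum>i\<in>F. if j \<in> D i then c i * T i j else 0)" for j
    have finG: "finite G" using A fin by (auto simp: G_def)
    have "(\<Sum>j\<in>G. e j * a j) = (\<Sum>i\<in>F. \<Sum>j\<in>G. if j \<in> D i then c i * T i j * a j else 0)"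
      unfolding e_def by (subst sum.swap) (simp add: sum_distrib_right if_distrib[of "\<lambda>x. x * _"] cong: if_cong)
    also have "\<dots> = (\<Sum>i\<in>F. c i * b i)"
    proof (rule sum.cong[OF refl])
      fix i assume i: "i \<in> F"
      have "(\<Sum>j\<in>G. if j \<in> D i then c i * T i j * a j else 0) = (\<Sum>j\<in>D i. c i * T i j * a j)"
        by (rule sum.mono_neutral_cong_right) (use finG i in \<open>auto simp: G_def\<close>)
      then show "(\<Sum>j\<in>G. if j \<in> D i then c i * T i j * a j else 0) = c i * b i"
        by (simp add: b sum_distrib_left mult.assoc)
    qed
    finally have "(\<Sum>j\<in>G. e j * a j) = 0" using A by simp
    moreover have "e j \<in> C" for j
    proof -
      have "(\<Sum>i\<in>F'. if j \<in> D i then c i * T i j else 0) \<in> C" if "finite F'" "F' \<subseteq> F" for F'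
        using that by (induction F') (auto intro!: C0 Cadd Cmult T simp: A)
      then show ?thesis using A by (simp add: e_def)
    qed
    moreover have "k \<in> G" using k diag by (auto simp: G_def)
    ultimately have "e k = 0"
      using lin_indepD[OF indep C0 finG, of e k] by auto
    moreover have "e k = (\<Sum>i\<in>F. if i = k then c k * T k k else 0)"
      unfolding e_def
    proof (rule sum.cong[OF refl])
      fix i assume i: "i \<in> F"
      show "(if k \<in> D i then c i * T i k else 0) = (if i = k then c k * T k k else 0)"
        using kmax[OF i] le[of k i] diag(1)[of k] by (cases "c i = 0") (auto simp: k)
    qed
    ultimately show False using A k diag(2)[of k] by simp
  qed
qed

text \<open>Forward substitution, by induction on the size of \<open>D i\<close>: the sets \<open>D j\<close> for \<open>j \<in> D i\<close> other than \<open>i\<close>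
  are proper subsets of \<open>D i\<close>, as they do not contain \<open>i\<close>.\<close>

lemma triangular_inverse:
  fixes a b :: "'i::linorder \<Rightarrow> 'a::idom"
  assumes C0: "0 \<in> C" and Cadd: "\<And>x y. x \<in> C \<Longrightarrow> y \<in> C \<Longrightarrow> x + y \<in> C"
    and Cmult: "\<And>x y. x \<in> C \<Longrightarrow> y \<in> C \<Longrightarrow> x * y \<in> C" and Cminus: "\<And>x. x \<in> C \<Longrightarrow> - x \<in> C"
    and fin: "\<And>i. finite (D i)" and le: "\<And>i j. j \<in> D i \<Longrightarrow> j \<le> i"
    and trans: "\<And>i j. j \<in> D i \<Longrightarrow> D j \<subseteq> D i" and diag: "\<And>i. i \<in> D i"
    and T: "\<And>i j. T i j \<in> C" and R: "\<And>i. R i \<in> C" "\<And>i. R i * T i i = 1"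
    and b: "\<And>i. b i = (\<Sum>j\<in>D i. T i j * a j)"
  shows "\<exists>U. (\<forall>i j. U i j \<in> C) \<and> (\<forall>i. U i i \<noteq> 0) \<and> (\<forall>i. a i = (\<Sum>j\<in>D i. U i j * b j))"
proof -
  have "\<exists>U. (\<forall>j. U j \<in> C) \<and> U i \<noteq> 0 \<and> a i = (\<Sum>j\<in>D i. U j * b j)" for i
  proof (induction "card (D i)" arbitrary: i rule: less_induct)
    case less
    have "\<exists>U. (\<forall>k. U k \<in> C) \<and> a j = (\<Sum>k\<in>D j. U k * b k)" if j: "j \<in> D i - {i}" for j
    proof -
      have "i \<notin> D j" using le[of i j] le[of j i] j by auto
      then have "D j \<subset> D i" using trans[of j i] j diag[of i] by blast
      then show ?thesis using less[of j] psubset_card_mono[OF fin] by blast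
    qed
    then obtain V where V: "\<And>j k. j \<in> D i - {i} \<Longrightarrow> V j k \<in> C"
      "\<And>j. j \<in> D i - {i} \<Longrightarrow> a j = (\<Sum>k\<in>D j. V j k * b k)" by metis
    define W where "W k = (\<Sum>j\<in>D i - {i}. if k \<in> D j then R i * T i j * V j k else 0)" for k
    define U where "U k = (if k = i then R i else 0) + - W k" for k
    have W: "W k \<in> C" for k
    proof -
      have "(\<Sum>j\<in>J. if k \<in> D j then R i * T i j * V j k else 0) \<in> C" if "finite J" "J \<subseteq> D i - {i}" for J
        using that by (induction J) (auto intro!: C0 Cadd Cmult T R V)
      then show ?thesis using fin by (simp add: W_def)
    qed
    have "W i = 0"
      unfolding W_def using le by (intro sum.neutral) (auto dest: le intro: antisym)
    moreover have "R i \<noteq> 0" using R(2)[of i] by auto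
    ultimately have "U i \<noteq> 0" by (simp add: U_def)
    moreover have "U k \<in> C" for k
      unfolding U_def by (intro Cadd Cminus W) (auto intro: R C0)
    moreover have "a i = (\<Sum>k\<in>D i. U k * b k)"
    proof -
      have "(\<Sum>k\<in>D i. W k * b k) =
          (\<Sum>j\<in>D i - {i}. \<Sum>k\<in>D i. if k \<in> D j then R i * T i j * V j k * b k else 0)"
        unfolding W_def by (subst sum.swap) (simp add: sum_distrib_right if_distrib[of "\<lambda>x. x * _"] cong: if_cong)
      also have "\<dots> = (\<Sum>j\<in>D i - {i}. R i * T i j * a j)"
      proof (rule sum.cong[OF refl])
        fix j assume j: "j \<in> D i - {i}"
        have "(\<Sum>k\<in>D i. if k \<in> D j then R i * T i j * V j k * b k else 0) =
            (\<Sum>k\<in>D j. R i * T i j * V j k * b k)"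
          by (rule sum.mono_neutral_cong_right) (use fin trans[of j i] j in auto)
        then show "(\<Sum>k\<in>D i. if k \<in> D j then R i * T i j * V j k * b k else 0) = R i * T i j * a j"
          using V(2)[OF j] by (simp add: sum_distrib_left mult.assoc)
      qed
      finally have W: "(\<Sum>k\<in>D i. W k * b k) = (\<Sum>j\<in>D i - {i}. R i * T i j * a j)" .
      have "R i * b i = (\<Sum>j\<in>D i. R i * T i j * a j)"
        by (simp add: b sum_distrib_left mult.assoc)
      also have "\<dots> = a i + (\<Sum>j\<in>D i - {i}. R i * T i j * a j)"
        using R(2) by (simp add: sum.remove[OF fin diag])
      finally have "a i = R i * b i - (\<Sum>k\<in>D i. W k * b k)" by (simp add: W)
      also have "\<dots> = (\<Sum>k\<in>D i. U k * b k)"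
        using fin[of i] diag[of i]
        by (simp add: U_def algebra_simps sum_subtractf if_distrib[of "\<lambda>x. _ * x"] cong: if_cong)
      finally show ?thesis .
    qed
    ultimately show ?case by blast
  qed
  then show ?thesis by metis
qed

text \<open>Nonincreasing sequences of Lyndon words are both the words and the monomials in Lyndon words.\<close>

definition lyndon_exponents :: "'x::linorder list \<Rightarrow> ('x list \<Rightarrow>\<^sub>0 nat)" where
  "lyndon_exponents w = Abs_poly_mapping (count (mset (lyndon_fact w)))"

lemma lookup_lyndon_exponents:
  "Poly_Mapping.lookup (lyndon_exponents w) = count (mset (lyndon_fact w))"
  unfolding lyndon_exponents_def
  by (rule lookup_Abs_poly_mapping) (simp add: finite_set_mset[unfolded set_mset_def])

lemma keys_lyndon_exponents: "Poly_Mapping.keys (lyndon_exponents w) = set (lyndon_fact w)"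
  by (simp add: Poly_Mapping.keys.rep_eq lookup_lyndon_exponents)

lemma lyndon_fact_eqI:
  assumes "mset (lyndon_fact v) = mset (lyndon_fact w)"
  shows "v = w"
proof -
  have f: "is_lyndon_fact v (lyndon_fact v)" "is_lyndon_fact w (lyndon_fact w)"
    by (rule is_lyndon_fact_lyndon_fact)+
  then have "sorted (rev (lyndon_fact v))" "sorted (rev (lyndon_fact w))"
    by (simp_all add: is_lyndon_fact_def sorted_wrt_rev)
  then have "rev (lyndon_fact v) = rev (lyndon_fact w)"
    using assms by (metis mset_rev properties_for_sort)
  then show ?thesis using f by (simp add: is_lyndon_fact_def)
qed

lemma bij_lyndon_exponents:
  "bij_betw (lyndon_exponents :: 'x::linorder list \<Rightarrow> _) UNIV {m. Poly_Mapping.keys m \<subseteq> {l. lyndon l}}"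
proof (rule bij_betwI')
  show "(lyndon_exponents v = lyndon_exponents w) = (v = w)" for v w :: "'x list"
    using lookup_lyndon_exponents lyndon_fact_eqI by (metis multiset_eqI)
  show "lyndon_exponents w \<in> {m. Poly_Mapping.keys m \<subseteq> {l. lyndon l}}" for w :: "'x list"
    using is_lyndon_fact_lyndon_fact[of w] by (auto simp: keys_lyndon_exponents is_lyndon_fact_def)
next
  fix m :: "'x list \<Rightarrow>\<^sub>0 nat"
  assume m: "m \<in> {m. Poly_Mapping.keys m \<subseteq> {l. lyndon l}}"
  define M where "M = Abs_multiset (Poly_Mapping.lookup m)"
  have M: "count M = Poly_Mapping.lookup m"
    unfolding M_def by (rule count_Abs_multiset) simp
  define ls where "ls = rev (sorted_list_of_multiset M)"
  have "set_mset M \<subseteq> {l. lyndon l}"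
    using m by (auto simp: set_mset_def M in_keys_iff subset_iff)
  then have "is_lyndon_fact (concat ls) ls"
    by (auto simp: is_lyndon_fact_def ls_def sorted_wrt_rev)
  then have "lyndon_fact (concat ls) = ls"
    using is_lyndon_fact_lyndon_fact lyndon_fact_unique by blast
  then have "Poly_Mapping.lookup (lyndon_exponents (concat ls)) = Poly_Mapping.lookup m"
    by (simp add: lookup_lyndon_exponents ls_def M)
  then show "\<exists>w\<in>UNIV. m = lyndon_exponents w"
    by (metis UNIV_I poly_mapping_eqI)
qed

lemma monomial_lyndon_exponents: "monomial S (lyndon_exponents w) = (\<Prod>l\<leftarrow>lyndon_fact w. S l)"
proof -
  have "(\<Prod>l\<leftarrow>lyndon_fact w. S l) = prod_mset (image_mset S (mset (lyndon_fact w)))"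
    by (metis mset_map prod_mset_prod_list)
  then show ?thesis
    by (simp add: monomial_def keys_lyndon_exponents lookup_lyndon_exponents image_prod_mset_multiplicity)
qed

text \<open>The monomials in the \<open>\<langle>S | l\<rangle>\<close> are indexed by words through their Lyndon factors, and as such they
  are triangular over the \<open>\<langle>S | w\<rangle>\<close> within each multidegree. Both directions are the triangularity
  lemma, since the diagonal consists of positive integers, which are invertible in \<open>C\<close>.\<close>

theorem lin_indep_iff_alg_indep_lyndon:
  fixes \<iota> :: "complex \<Rightarrow> 'a::idom" and S :: "('x::linorder, 'a) series"
  assumes alg: "complex_algebra \<iota>" and C: "differential_subring \<delta> C" "range \<iota> \<subseteq> C"
    and S: "grouplike S"
  shows "lin_indep C UNIV S \<longleftrightarrow> alg_indep C {l. lyndon l} S"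
proof -
  note ring = subring_0[OF C(1)] subring_add[OF C(1)] subring_mult[OF C(1)]
  define N where "N w = (\<Prod>l\<leftarrow>lyndon_fact w. S l)" for w
  define D where "D w = {v \<in> words_of (mset w). v \<le> w}" for w :: "'x list"
  define T where "T w v = (of_nat (lyndon_coeff w v) :: 'a)" for w v :: "'x list"
  define R where "R w = \<iota> (1 / of_nat (lyndon_coeff w w))" for w :: "'x list"
  have fin: "finite (D w)" for w
    using finite_words_of[of "mset w"] by (simp add: D_def)
  have le: "v \<le> w" if "v \<in> D w" for v w using that by (simp add: D_def)
  have trans: "D v \<subseteq> D w" if "v \<in> D w" for v w using that by (auto simp: D_def)
  have diag: "w \<in> D w" for w by (simp add: D_def)
  have T: "T w v \<in> C" for w v by (simp add: T_def subring_of_nat[OF C(1)])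
  have R: "R w \<in> C" "R w * T w w = 1" for w
    using C(2) complex_algebra_inverse[OF alg lyndon_coeff_diag] by (auto simp: R_def T_def)
  then have T0: "T w w \<noteq> 0" for w by (metis mult_zero_right zero_neq_one)
  have N: "N w = (\<Sum>v\<in>D w. T w v * S v)" for w
    unfolding N_def D_def T_def by (rule prod_lyndon_fact[OF S])
  have "alg_indep C {l. lyndon l} S \<longleftrightarrow> lin_indep C UNIV N"
    unfolding alg_indep_alt lin_indep_reindex[OF ring(1) bij_lyndon_exponents]
    by (simp add: monomial_lyndon_exponents N_def[abs_def])
  moreover have "lin_indep C UNIV N" if "lin_indep C UNIV S"
    by (rule lin_indep_triangular[where D = D and T = T and a = S])
      (fact ring fin le diag T T0 N that)+
  moreover have "lin_indep C UNIV S" if "lin_indep C UNIV N"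
  proof -
    obtain U where U: "\<And>i j. U i j \<in> C" "\<And>i. U i i \<noteq> 0" "\<And>i. S i = (\<Sum>j\<in>D i. U i j * N j)"
      using triangular_inverse[where D = D and T = T and a = S and b = N and R = R and C = C,
          OF ring subring_uminus[OF C(1)] fin le trans diag T R N] by blast
    show ?thesis
      by (rule lin_indep_triangular[where D = D and T = U and a = N])
        (fact ring fin le diag U that)+
  qed
  ultimately show ?thesis by blast
qed

text \<open>The letters are Lyndon words.\<close>

lemma alg_indep_letters:
  fixes S :: "('x::linorder, 'a::comm_ring_1) series"
  assumes C: "0 \<in> C" and indep: "alg_indep C {l. lyndon l} S"
  shows "alg_indep C UNIV (\<lambda>x. S [x])"
proof -
  define f where "f m = Abs_poly_mapping (\<lambda>l. case l of [x] \<Rightarrow> Poly_Mapping.lookup m x | _ \<Rightarrow> 0)"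
    for m :: "'x \<Rightarrow>\<^sub>0 nat"
  have lk: "Poly_Mapping.lookup (f m) = (\<lambda>l. case l of [x] \<Rightarrow> Poly_Mapping.lookup m x | _ \<Rightarrow> 0)" for m
    unfolding f_def
  proof (rule lookup_Abs_poly_mapping)
    show "finite {l. (case l of [x] \<Rightarrow> Poly_Mapping.lookup m x | _ \<Rightarrow> 0) \<noteq> 0}"
      by (rule finite_subset[of _ "(\<lambda>x. [x]) ` Poly_Mapping.keys m"])
        (auto simp: in_keys_iff split: list.split_asm)
  qed
  have keys: "Poly_Mapping.keys (f m) = (\<lambda>x. [x]) ` Poly_Mapping.keys m" for m
    by (auto simp: in_keys_iff lk split: list.splits)
  have "inj f"
  proof (rule injI)
    fix m n assume "f m = f n"
    then have "Poly_Mapping.lookup (f m) [x] = Poly_Mapping.lookup (f n) [x]" for x by simp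
    then show "m = n" by (simp add: lk poly_mapping_eqI)
  qed
  then have bij: "bij_betw f UNIV (range f)" by (simp add: bij_betw_def)
  have "lin_indep C (range f) (monomial S)"
    by (rule lin_indep_mono[OF indep[unfolded alg_indep_alt]]) (auto simp: keys)
  then have "lin_indep C UNIV (\<lambda>m. monomial S (f m))"
    by (simp add: lin_indep_reindex[OF C bij])
  moreover have "monomial S (f m) = monomial (\<lambda>x. S [x]) m" for m
    by (simp add: monomial_def keys sum.reindex prod.reindex inj_on_def lk)
  ultimately show ?thesis by (simp add: alg_indep_alt)
qed

text \<open>\<open>1\<close> and the single letters are among the monomials.\<close>

lemma lin_indep_letters:
  fixes S :: "('x, 'a::comm_ring_1) series"
  assumes C: "0 \<in> C" and S: "S [] = 1" and indep: "alg_indep C UNIV (\<lambda>x. S [x])"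
  shows "lin_indep C (range (\<lambda>x. [x]) \<union> {[]}) S"
proof -
  let ?I = "range (\<lambda>x. [x]) \<union> {[]} :: 'x list set"
  define f where "f w = (case w of [] \<Rightarrow> 0 | x # _ \<Rightarrow> Poly_Mapping.single x (Suc 0))" for w :: "'x list"
  have ne: "Poly_Mapping.single x (Suc 0) \<noteq> 0" for x :: 'x
    by (metis lookup_single_eq lookup_zero nat.distinct(1))
  have sg: "x = y" if "Poly_Mapping.single x (Suc 0) = Poly_Mapping.single y (Suc 0)" for x y :: 'x
    using arg_cong[OF that, of "\<lambda>p. Poly_Mapping.lookup p x"]
    by (auto simp: lookup_single when_def split: if_splits)
  have "inj_on f ?I"
    by (rule inj_onI) (auto simp: f_def ne ne[symmetric] dest: sg)
  then have bij: "bij_betw f ?I (f ` ?I)" by (simp add: bij_betw_def)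
  have "lin_indep C (f ` ?I) (monomial (\<lambda>x. S [x]))"
    by (rule lin_indep_mono[OF indep[unfolded alg_indep_alt]]) auto
  then have "lin_indep C ?I (\<lambda>w. monomial (\<lambda>x. S [x]) (f w))"
    using lin_indep_reindex[OF C bij] by blast
  then show ?thesis
    by (rule lin_indep_cong) (use S in \<open>auto simp: monomial_def f_def\<close>)
qed

section \<open>The field of fractions of the coefficient ring\<close>

lemma
  fixes C :: "'a::idom set"
  assumes C: "differential_subring \<delta> C"
  shows Frac_to_fract: "a \<in> C \<Longrightarrow> to_fract a \<in> Frac C"
    and Frac_add: "x \<in> Frac C \<Longrightarrow> y \<in> Frac C \<Longrightarrow> x + y \<in> Frac C"
    and Frac_mult: "x \<in> Frac C \<Longrightarrow> y \<in> Frac C \<Longrightarrow> x * y \<in> Frac C"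
    and Frac_uminus: "x \<in> Frac C \<Longrightarrow> - x \<in> Frac C"
    and Frac_divide: "x \<in> Frac C \<Longrightarrow> y \<in> Frac C \<Longrightarrow> x / y \<in> Frac C"
    and Frac_deriv: "derivation \<delta> \<Longrightarrow> x \<in> Frac C \<Longrightarrow> fract_deriv \<delta> x \<in> Frac C"
proof -
  note ring = subring_0[OF C] subring_1[OF C] subring_uminus[OF C] subring_add[OF C]
    subring_mult[OF C] subring_diff[OF C] subring_deriv[OF C]
  have I: "Fract a b \<in> Frac C" if "a \<in> C" "b \<in> C" "b \<noteq> 0" for a b
    using that by (auto simp: Frac_def)
  have E: "\<exists>a b. x = Fract a b \<and> a \<in> C \<and> b \<in> C \<and> b \<noteq> 0" if "x \<in> Frac C" for x
    using that by (auto simp: Frac_def)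
  show fr: "to_fract a \<in> Frac C" if "a \<in> C" for a
    using that by (simp add: to_fract_def I ring)
  { fix x y assume "x \<in> Frac C" "y \<in> Frac C"
    then obtain a b c d where x: "x = Fract a b" "a \<in> C" "b \<in> C" "b \<noteq> 0"
      and y: "y = Fract c d" "c \<in> C" "d \<in> C" "d \<noteq> 0" using E by metis
    show "x + y \<in> Frac C" using x y by (simp add: I ring)
    show "x * y \<in> Frac C" using x y by (simp add: I ring)
    show "x / y \<in> Frac C"
    proof (cases "c = 0")
      case True
      then have "y = 0" using y by (simp add: Fract_conv_to_fract)
      then show ?thesis using fr[OF ring(1)] by simp
    qed (use x y in \<open>simp add: I ring\<close>)
  }
  show "- x \<in> Frac C" if "x \<in> Frac C" for x
    using E[OF that] by (auto simp: I ring)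
  show "fract_deriv \<delta> x \<in> Frac C" if "derivation \<delta>" "x \<in> Frac C" for x
    using E[OF that(2)] by (auto simp: fract_deriv_Fract[OF that(1)] I ring)
qed

lemma Frac_sum:
  assumes "differential_subring \<delta> C" "\<And>i. i \<in> I \<Longrightarrow> f i \<in> Frac C"
  shows "(\<Sum>i\<in>I. f i) \<in> Frac C"
  using assms(2)
proof (induction I rule: infinite_finite_induct)
  case (insert i I)
  then show ?case by (simp add: Frac_add[OF assms(1)])
qed (use Frac_to_fract[OF assms(1) subring_0[OF assms(1)]] in auto)

section \<open>Linear relations between the coefficients of a solution\<close>

text \<open>\<open>\<langle>S | P\<rangle>\<close> for a polynomial \<open>P\<close> with coefficients in the field of fractions, where a leading
  coefficient can be scaled to \<open>1\<close>.\<close>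

definition relation_value :: "('x, 'a::idom) series \<Rightarrow> ('x list \<Rightarrow> 'a fract) \<Rightarrow> 'a fract" where
  "relation_value S P = (\<Sum>w | P w \<noteq> 0. P w * to_fract (S w))"

lemma relation_value_superset:
  assumes "finite F" "{w. P w \<noteq> 0} \<subseteq> F"
  shows "relation_value S P = (\<Sum>w\<in>F. P w * to_fract (S w))"
  unfolding relation_value_def by (rule sum.mono_neutral_left) (use assms in auto)

text \<open>The derivative \<open>\<partial>P + M\<^sup>\<dagger> P\<close> of a relation, where \<open>M\<^sup>\<dagger>\<close> is adjoint to the left
  multiplication by \<open>M\<close>.\<close>

definition relation_deriv ::
    "('a::idom \<Rightarrow> 'a) \<Rightarrow> ('x \<Rightarrow> 'a) \<Rightarrow> ('x list \<Rightarrow> 'a fract) \<Rightarrow> 'x list \<Rightarrow> 'a fract" where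
  "relation_deriv \<delta> u P w = fract_deriv \<delta> (P w) + (\<Sum>x | P (x # w) \<noteq> 0. P (x # w) * to_fract (u x))"

lemma letter_series_conc: "conc (letter_series u) S w = (case w of [] \<Rightarrow> 0 | x # v \<Rightarrow> u x * S v)"
proof (cases w)
  case (Cons x v)
  have *: "(\<lambda>v. letter_series u (x # v)) = (\<lambda>v. u x * word [] v)"
    by (auto simp: letter_series_def word_def fun_eq_iff split: list.split)
  show ?thesis
    unfolding Cons conc_Cons * conc_scale_left by (simp add: letter_series_def)
qed (simp add: letter_series_def)

lemma relation_deriv_support:
  assumes der: "derivation \<delta>" and "relation_deriv \<delta> u P w \<noteq> 0"
  shows "P w \<noteq> 0 \<or> (\<exists>x. P (x # w) \<noteq> 0)"
proof (rule ccontr)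
  assume "\<not> ?thesis"
  then show False
    using assms derivation_0[OF fract_deriv(1)[OF der]] by (simp add: relation_deriv_def)
qed

text \<open>\<open>\<partial>\<langle>S | P\<rangle> = \<langle>\<partial>S | P\<rangle> + \<langle>S | \<partial>P\<rangle>\<close> with \<open>\<partial>S = M S\<close>.\<close>

lemma relation_value_deriv:
  assumes der: "derivation \<delta>" and sol: "solution \<delta> (letter_series u) S"
    and fin: "finite {w. P w \<noteq> 0}"
  shows "relation_value S (relation_deriv \<delta> u P) = fract_deriv \<delta> (relation_value S P)"
    and "finite {w. relation_deriv \<delta> u P w \<noteq> 0}"
proof -
  let ?D = "fract_deriv \<delta>" and ?s = "\<lambda>w. to_fract (S w)" and ?Q = "relation_deriv \<delta> u P"
  let ?W = "{w. P w \<noteq> 0}"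
  note D = fract_deriv(1)[OF der]
  have dS: "\<delta> (S w) = (case w of [] \<Rightarrow> 0 | x # v \<Rightarrow> u x * S v)" for w
    using sol letter_series_conc[of u S w] by (simp add: solution_def deriv_series_def fun_eq_iff)
  define F where "F = ?W \<union> tl ` ?W"
  have finF: "finite F" using fin by (simp add: F_def)
  have sub: "{w. ?Q w \<noteq> 0} \<subseteq> F"
    using relation_deriv_support[OF der] by (force simp: F_def image_iff)
  then show "finite {w. ?Q w \<noteq> 0}" using finF by (rule finite_subset)
  have "?D (relation_value S P) = (\<Sum>w\<in>?W. ?D (P w) * ?s w) + (\<Sum>w\<in>?W. P w * to_fract (\<delta> (S w)))"
    unfolding relation_value_def
    by (simp add: derivation_sum[OF D] derivation_mult[OF D] fract_deriv(2)[OF der] sum.distrib)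
  also have "(\<Sum>w\<in>?W. ?D (P w) * ?s w) = (\<Sum>w\<in>F. ?D (P w) * ?s w)"
    by (rule sum.mono_neutral_left) (use finF derivation_0[OF D] in \<open>auto simp: F_def\<close>)
  also have "(\<Sum>w\<in>?W. P w * to_fract (\<delta> (S w))) =
      (\<Sum>w\<in>?W - {[]}. P w * to_fract (\<delta> (S w)))"
    by (rule sum.mono_neutral_right) (use fin in \<open>auto simp: dS\<close>)
  also have "\<dots> = (\<Sum>(w, x)\<in>Sigma F (\<lambda>w. {x. P (x # w) \<noteq> 0}). P (x # w) * to_fract (u x) * ?s w)"
    by (rule sum.reindex_bij_witness[of _ "\<lambda>(w, x). x # w" "\<lambda>w. (tl w, hd w)"])
      (auto simp: F_def dS image_iff neq_Nil_conv mult.assoc split: list.split)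
  also have "\<dots> = (\<Sum>w\<in>F. (\<Sum>x | P (x # w) \<noteq> 0. P (x # w) * to_fract (u x)) * ?s w)"
  proof -
    have "finite {x. P (x # w) \<noteq> 0}" for w
      by (rule finite_imageD[of "\<lambda>x. x # w"]) (auto intro: finite_subset[OF _ fin] inj_onI)
    then show ?thesis
      using finF by (subst sum.Sigma[symmetric]) (auto simp: sum_distrib_right)
  qed
  finally show "relation_value S ?Q = ?D (relation_value S P)"
    unfolding relation_value_superset[OF finF sub]
    by (simp add: relation_deriv_def distrib_right sum.distrib)
qed

text \<open>The induction is on the degree of a relation, then on the number of its words of that degree.
  Scale one of its leading coefficients to \<open>1\<close>: then the derivative of the relation has
  fewer leading words, so it vanishes. Its coefficients at the leading words then say that the
  leading coefficients are constant, and its coefficient one degree lower writes a nontrivial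
  constant combination of the \<open>u x\<close> as a derivative.\<close>

lemma relation_trivial:
  fixes \<iota> :: "complex \<Rightarrow> 'a::idom" and S :: "('x, 'a) series"
  assumes alg: "complex_algebra \<iota>" and der: "derivation \<delta>"
    and C: "differential_subring \<delta> C" and u: "\<And>x. u x \<in> C"
    and sol: "solution \<delta> (letter_series u) S"
    and const: "\<And>g. g \<in> Frac C \<Longrightarrow> fract_deriv \<delta> g = 0 \<Longrightarrow> \<exists>z. g = to_fract (\<iota> z)"
    and free: "\<And>g F z x. g \<in> Frac C \<Longrightarrow> finite F \<Longrightarrow>
      (\<Sum>x\<in>F. to_fract (\<iota> (z x) * u x)) = fract_deriv \<delta> g \<Longrightarrow> x \<in> F \<Longrightarrow> z x = 0"
    and fin: "finite {w. P w \<noteq> 0}" and PC: "\<And>w. P w \<in> Frac C"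
    and rel: "relation_value S P = 0"
  shows "P w = 0"
proof -
  let ?D = "fract_deriv \<delta>"
  note D = fract_deriv(1)[OF der]
  have S1: "S [] = 1" using sol by (simp add: solution_def)
  have "\<forall>P. finite {w. P w \<noteq> 0} \<longrightarrow> (\<forall>w. P w \<in> Frac C) \<longrightarrow> relation_value S P = 0 \<longrightarrow>
      (\<forall>w. P w \<noteq> 0 \<longrightarrow> length w < n) \<longrightarrow> (\<forall>w. P w = 0)" for n
  proof (induction n)
    case 0
    then show ?case by auto
  next
    case (Suc n)
    have step: "\<forall>w. P w = 0" if "finite {w. P w \<noteq> 0}" "\<And>w. P w \<in> Frac C" "relation_value S P = 0"
        "\<And>w. P w \<noteq> 0 \<Longrightarrow> length w \<le> n" for P
      using that
    proof (induction "card {w. P w \<noteq> 0 \<and> length w = n}" arbitrary: P rule: less_induct)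
      case less
      note fin = less.prems(1) and PC = less.prems(2) and rel = less.prems(3) and deg = less.prems(4)
      show ?case
      proof (cases "\<exists>w0. P w0 \<noteq> 0 \<and> length w0 = n")
        case False
        then have "length w < n" if "P w \<noteq> 0" for w
          using deg[OF that] that by (metis le_neq_implies_less)
        then show ?thesis using Suc.IH fin PC rel by blast
      next
        case True
        then obtain w0 where w0: "P w0 \<noteq> 0" "length w0 = n" by blast
        define P1 where "P1 w = P w / P w0" for w
        have supp: "P1 w \<noteq> 0 \<longleftrightarrow> P w \<noteq> 0" for w using w0 by (simp add: P1_def)
        have P1C: "P1 w \<in> Frac C" for w by (simp add: P1_def Frac_divide[OF C] PC)
        have fin1: "finite {w. P1 w \<noteq> 0}" using fin by (simp add: supp)
        have "relation_value S P1 = relation_value S P / P w0"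
          by (simp add: relation_value_def supp) (simp add: P1_def sum_divide_distrib)
        then have rel1: "relation_value S P1 = 0" by (simp add: rel)
        define Q where "Q = relation_deriv \<delta> u P1"
        have top: "Q w = ?D (P1 w)" if "length w = n" for w
        proof -
          have "P1 (x # w) = 0" for x using deg[of "x # w"] that supp by fastforce
          then show ?thesis by (simp add: Q_def relation_deriv_def)
        qed
        \<comment> \<open>\<open>Q\<close> loses \<open>w0\<close>, where \<open>P1\<close> has the coefficient \<open>1\<close> with derivative \<open>0\<close>\<close>
        have sub: "{w. Q w \<noteq> 0 \<and> length w = n} \<subset> {w. P w \<noteq> 0 \<and> length w = n}"
        proof -
          have "Q w0 = 0" using w0 by (simp add: top P1_def derivation_1[OF D])
          moreover have "P w \<noteq> 0" if "Q w \<noteq> 0" "length w = n" for w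
            using that top[of w] derivation_0[OF D] supp by metis
          ultimately show ?thesis using w0 by blast
        qed
        have Q0: "\<forall>w. Q w = 0"
        proof (rule less.hyps)
          show "card {w. Q w \<noteq> 0 \<and> length w = n} < card {w. P w \<noteq> 0 \<and> length w = n}"
            by (rule psubset_card_mono[OF _ sub]) (rule finite_subset[OF _ fin], auto)
          show "finite {w. Q w \<noteq> 0}"
            unfolding Q_def by (rule relation_value_deriv(2)[OF der sol fin1])
          show "relation_value S Q = 0"
            unfolding Q_def relation_value_deriv(1)[OF der sol fin1] rel1 by (rule derivation_0[OF D])
          show "Q w \<in> Frac C" for w
            unfolding Q_def relation_deriv_def
            by (intro Frac_add[OF C] Frac_sum[OF C] Frac_mult[OF C] Frac_deriv[OF C der] P1C
                Frac_to_fract[OF C] u)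
          show "length w \<le> n" if "Q w \<noteq> 0" for w
            using relation_deriv_support[OF der that[unfolded Q_def]] deg[of w] deg[of "_ # w"] supp
            by fastforce
        qed
        have "\<exists>z. P1 w = to_fract (\<iota> z)" if "length w = n" for w
          using const[OF P1C] top[OF that] Q0 by auto
        then obtain z where z: "\<And>w. length w = n \<Longrightarrow> P1 w = to_fract (\<iota> (z w))" by metis
        \<comment> \<open>a relation of degree \<open>0\<close> says \<open>\<langle>S | 1\<rangle> = 0\<close>; otherwise drop the first letter of \<open>w0\<close>\<close>
        have False
        proof (cases w0)
          case Nil
          then have "{w. P1 w \<noteq> 0} \<subseteq> {[]}" using w0 deg supp by auto
          then have "relation_value S P1 = 1"
            using w0 Nil by (subst relation_value_superset[of "{[]}"]) (auto simp: P1_def S1)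
          then show False using rel1 by simp
        next
          case (Cons x0 w1)
          let ?X = "{x. P1 (x # w1) \<noteq> 0}"
          have len: "length (x # w1) = n" for x using Cons w0 by simp
          have "finite ?X"
            by (rule finite_imageD[of "\<lambda>x. x # w1"]) (auto intro: finite_subset[OF _ fin1] inj_onI)
          moreover have "- P1 w1 \<in> Frac C" by (rule Frac_uminus[OF C P1C])
          moreover have "(\<Sum>x\<in>?X. to_fract (\<iota> (z (x # w1)) * u x)) = ?D (- P1 w1)"
            using Q0[rule_format, of w1] z[OF len]
            by (simp add: Q_def relation_deriv_def derivation_minus[OF D] eq_neg_iff_add_eq_0 add.commute)
          moreover have "x0 \<in> ?X" using w0 Cons supp by simp
          ultimately have "z (x0 # w1) = 0"
            using free[of "- P1 w1" ?X "\<lambda>x. z (x # w1)" x0] by blast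
          then show False using z[OF len, of x0] \<open>x0 \<in> ?X\<close> by (simp add: complex_algebra_0[OF alg])
        qed
        then show ?thesis ..
      qed
    qed
    show ?case
    proof (intro allI impI)
      fix P w
      assume P: "finite {w. P w \<noteq> 0}" "\<forall>w. P w \<in> Frac C" "relation_value S P = 0"
        "\<forall>w. P w \<noteq> 0 \<longrightarrow> length w < Suc n"
      have "length w \<le> n" if "P w \<noteq> 0" for w
        using P(4) that unfolding less_Suc_eq_le by blast
      then show "P w = 0" using step[of P] P(1-3) by blast
    qed
  qed
  moreover have "\<exists>n. \<forall>w. P w \<noteq> 0 \<longrightarrow> length w < n"
  proof -
    have "finite (length ` {w. P w \<noteq> 0})" using fin by simp
    then show ?thesis unfolding finite_nat_set_iff_bounded by auto
  qed
  ultimately show ?thesis using fin PC rel by blast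
qed

section \<open>Independence criteria\<close>

lemma poly_mapping_on_exists:
  assumes "finite F"
  obtains k where "Poly_Mapping.keys k \<subseteq> F" "\<And>x. x \<in> F \<Longrightarrow> Poly_Mapping.lookup k x = z x"
proof
  have fin: "finite {x. (if x \<in> F then z x else 0) \<noteq> 0}"
    by (rule finite_subset[OF _ assms]) auto
  let ?k = "Abs_poly_mapping (\<lambda>x. if x \<in> F then z x else 0)"
  have lk: "Poly_Mapping.lookup ?k = (\<lambda>x. if x \<in> F then z x else 0)"
    by (rule lookup_Abs_poly_mapping[OF fin])
  show "Poly_Mapping.keys ?k \<subseteq> F" by (auto simp: in_keys_iff lk split: if_splits)
  show "Poly_Mapping.lookup ?k x = z x" if "x \<in> F" for x using that by (simp add: lk)
qed

text \<open>The common form of the two conditions on the \<open>u x\<close>. A finite index set with an arbitrary function on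
  it replaces finitely supported maps, so that coefficients can be read off from a relation.\<close>

definition no_primitive :: "(complex \<Rightarrow> 'a::idom) \<Rightarrow> ('a \<Rightarrow> 'a) \<Rightarrow> 'a set \<Rightarrow> ('x \<Rightarrow> 'a) \<Rightarrow> bool" where
  "no_primitive \<iota> \<delta> C u \<longleftrightarrow> (\<forall>g\<in>Frac C. \<forall>F z. finite F \<and>
     (\<Sum>x\<in>F. to_fract (\<iota> (z x) * u x)) = fract_deriv \<delta> g \<longrightarrow> (\<forall>x\<in>F. z x = 0))"

lemma no_primitive_conv_poly_mapping:
  assumes alg: "complex_algebra \<iota>"
  shows "no_primitive \<iota> \<delta> C u \<longleftrightarrow>
    (\<forall>g\<in>Frac C. \<forall>k. (\<Sum>x\<in>Poly_Mapping.keys k. to_fract (\<iota> (Poly_Mapping.lookup k x) * u x)) =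
      fract_deriv \<delta> g \<longrightarrow> (\<forall>x. Poly_Mapping.lookup k x = 0))" (is "_ \<longleftrightarrow> ?R")
proof
  assume L: "no_primitive \<iota> \<delta> C u"
  show ?R
  proof (intro ballI allI impI)
    fix g k x
    assume g: "g \<in> Frac C" and
      eq: "(\<Sum>x\<in>Poly_Mapping.keys k. to_fract (\<iota> (Poly_Mapping.lookup k x) * u x)) = fract_deriv \<delta> g"
    have "\<forall>x\<in>Poly_Mapping.keys k. Poly_Mapping.lookup k x = 0"
      using L g eq finite_keys unfolding no_primitive_def by blast
    then show "Poly_Mapping.lookup k x = 0" by (meson in_keys_iff)
  qed
next
  assume R: ?R
  show "no_primitive \<iota> \<delta> C u"
    unfolding no_primitive_def
  proof (intro ballI allI impI)
    fix g F z x
    assume g: "g \<in> Frac C" and x: "x \<in> F"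
      and A: "finite F \<and> (\<Sum>x\<in>F. to_fract (\<iota> (z x) * u x)) = fract_deriv \<delta> g"
    obtain k where k: "Poly_Mapping.keys k \<subseteq> F" "\<And>x. x \<in> F \<Longrightarrow> Poly_Mapping.lookup k x = z x"
      using poly_mapping_on_exists A by metis
    have "(\<Sum>x\<in>Poly_Mapping.keys k. to_fract (\<iota> (Poly_Mapping.lookup k x) * u x)) =
        (\<Sum>x\<in>F. to_fract (\<iota> (z x) * u x))"
      by (rule sum.mono_neutral_cong_left)
        (use A k in \<open>auto simp: in_keys_iff complex_algebra_0[OF alg]\<close>)
    then have "(\<Sum>x\<in>Poly_Mapping.keys k. to_fract (\<iota> (Poly_Mapping.lookup k x) * u x)) = fract_deriv \<delta> g"
      using A by simp
    then have "Poly_Mapping.lookup k x = 0" by (rule R[rule_format, OF g])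
    then show "z x = 0" using k x by simp
  qed
qed

lemma no_primitive_conv_span:
  fixes \<iota> :: "complex \<Rightarrow> 'a::idom" and u :: "'x \<Rightarrow> 'a"
  assumes alg: "complex_algebra \<iota>" and der: "derivation \<delta>" and C: "differential_subring \<delta> C"
  shows "no_primitive \<iota> \<delta> C u \<longleftrightarrow> lin_indep (range \<iota>) UNIV u \<and>
    fract_deriv \<delta> ` Frac C \<inter> to_fract ` module.span (\<lambda>z v. \<iota> z * v) (range u) = {0}"
    (is "_ \<longleftrightarrow> _ \<and> ?I = {0}")
proof -
  interpret module "\<lambda>z v. \<iota> z * v"
    by unfold_locales (use alg in \<open>auto simp: complex_algebra_def algebra_simps\<close>)
  note i0 = complex_algebra_0[OF alg] and D = fract_deriv(1)[OF der]
  have 0: "0 \<in> Frac C" "fract_deriv \<delta> 0 = 0" "0 \<in> range \<iota>"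
    using Frac_to_fract[OF C subring_0[OF C]] derivation_0[OF D] rangeI[of \<iota> 0] i0 by simp_all
  show ?thesis
  proof
    assume L: "no_primitive \<iota> \<delta> C u"
    have "lin_indep (range \<iota>) UNIV u"
      unfolding lin_indep_alt[OF 0(3)]
    proof (intro allI impI ballI)
      fix F c x
      assume A: "finite F \<and> F \<subseteq> UNIV \<and> (\<forall>x\<in>F. c x \<in> range \<iota>) \<and> (\<Sum>x\<in>F. c x * u x) = 0"
        and x: "x \<in> F"
      then have "\<forall>x\<in>F. \<exists>z. c x = \<iota> z" by auto
      then obtain z where z: "\<And>x. x \<in> F \<Longrightarrow> c x = \<iota> (z x)" by metis
      have "(\<Sum>x\<in>F. to_fract (\<iota> (z x) * u x)) = to_fract (\<Sum>x\<in>F. c x * u x)"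
        by (simp add: z)
      then have "z x = 0" using L A x 0 unfolding no_primitive_def by (metis to_fract_0)
      then show "c x = 0" using x by (simp add: z i0)
    qed
    moreover have "y = 0" if y: "y \<in> ?I" for y
    proof -
      obtain g v where g: "g \<in> Frac C" "y = fract_deriv \<delta> g" and v: "y = to_fract v" "v \<in> span (range u)"
        using y by auto
      obtain t r where t: "finite t" "t \<subseteq> range u" "v = (\<Sum>a\<in>t. \<iota> (r a) * a)"
        using v(2) unfolding span_explicit by blast
      define X where "X = inv u ` t"
      have "u (inv u a) = a" if "a \<in> t" for a
        using that t(2) by (auto intro: f_inv_into_f)
      then have X: "finite X" "inj_on u X" "t = u ` X"
        using t(1) by (auto simp: X_def inj_on_def image_image)
      have eq: "y = (\<Sum>x\<in>X. to_fract (\<iota> (r (u x)) * u x))"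
        using X by (simp add: v t sum.reindex)
      have "finite X \<and> (\<Sum>x\<in>X. to_fract (\<iota> (r (u x)) * u x)) = fract_deriv \<delta> g"
        using X(1) eq g(2) by (simp only: simp_thms)
      then have "r (u x) = 0" if "x \<in> X" for x
        by (rule L[unfolded no_primitive_def, rule_format, OF g(1)]) (rule that)
      then show "y = 0" using eq by (simp add: i0)
    qed
    moreover have "0 \<in> ?I"
      using 0 span_zero[of "range u"] by (force simp: image_iff)
    ultimately show "lin_indep (range \<iota>) UNIV u \<and> ?I = {0}" by blast
  next
    assume R: "lin_indep (range \<iota>) UNIV u \<and> ?I = {0}"
    show "no_primitive \<iota> \<delta> C u"
      unfolding no_primitive_def
    proof (intro ballI allI impI)
      fix g F z x
      assume g: "g \<in> Frac C" and x: "x \<in> F"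
        and A: "finite F \<and> (\<Sum>x\<in>F. to_fract (\<iota> (z x) * u x)) = fract_deriv \<delta> g"
      let ?v = "\<Sum>x\<in>F. \<iota> (z x) * u x"
      have "to_fract ?v = fract_deriv \<delta> g" using A by simp
      then have "to_fract ?v \<in> fract_deriv \<delta> ` Frac C" using g by (rule image_eqI)
      moreover have "?v \<in> span (range u)" by (intro span_sum span_scale span_base) auto
      then have "to_fract ?v \<in> to_fract ` span (range u)" by (rule imageI)
      ultimately have "to_fract ?v \<in> ?I" by (rule IntI)
      then have "?v = 0" unfolding conjunct2[OF R] by (simp only: singleton_iff to_fract_eq_0_iff)
      then have "\<iota> (z x) = 0"
        using lin_indepD[OF conjunct1[OF R] 0(3), of F "\<lambda>x. \<iota> (z x)" x] A x by auto
      then show "z x = 0" by (simp add: complex_algebra_eq_0_iff[OF alg])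
    qed
  qed
qed

text \<open>If \<open>\<Sum>\<^sub>x c\<^sub>x u\<^sub>x = \<partial>(p / q)\<close>, then \<open>\<Sum>\<^sub>x c\<^sub>x \<langle>S | x\<rangle> - p / q\<close> is a constant, so that \<open>1\<close> and the
  \<open>\<langle>S | x\<rangle>\<close> are linearly dependent.\<close>

lemma no_primitive_if_lin_indep_letters:
  fixes \<iota> :: "complex \<Rightarrow> 'a::idom" and S :: "('x, 'a) series"
  assumes alg: "complex_algebra \<iota>" and der: "derivation \<delta>" and const: "\<And>z. \<delta> (\<iota> z) = 0"
    and C: "differential_subring \<delta> C" "range \<iota> \<subseteq> C"
    and sol: "solution \<delta> (letter_series u) S" and nnc: "no_new_constants \<iota> \<delta> C"
    and indep: "lin_indep C (range (\<lambda>x. [x]) \<union> {[]}) S"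
  shows "no_primitive \<iota> \<delta> C u"
  unfolding no_primitive_def
proof (intro ballI allI impI)
  note ring = subring_0[OF C(1)] subring_uminus[OF C(1)] subring_add[OF C(1)] subring_mult[OF C(1)]
  note D = fract_deriv(1)[OF der]
  fix g F z x
  assume g: "g \<in> Frac C" and x: "x \<in> F"
    and A: "finite F \<and> (\<Sum>x\<in>F. to_fract (\<iota> (z x) * u x)) = fract_deriv \<delta> g"
  obtain p q where pq: "g = Fract p q" "p \<in> C" "q \<in> C" "q \<noteq> 0"
    using g by (auto simp: Frac_def)
  define s where "s = (\<Sum>x\<in>F. \<iota> (z x) * S [x])"
  have S1: "S [] = 1" using sol by (simp add: solution_def)
  have "\<delta> (S [x]) = u x" for x
    using sol letter_series_conc[of u S "[x]"] S1
    by (simp add: solution_def deriv_series_def fun_eq_iff)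
  then have "\<delta> s = (\<Sum>x\<in>F. \<iota> (z x) * u x)"
    by (simp add: s_def derivation_sum[OF der] derivation_mult[OF der] const)
  then have "fract_deriv \<delta> (to_fract s - g) = 0"
    using A by (simp add: derivation_diff[OF D] fract_deriv(2)[OF der])
  moreover have eq: "to_fract s - g = Fract (s * q - p) q"
    using pq by (simp add: to_fract_def)
  ultimately obtain c where "to_fract s - g = to_fract (\<iota> c)"
    using nnc pq unfolding no_new_constants_def by metis
  then have rel: "s * q - p = \<iota> c * q"
    using pq by (simp add: eq) (simp add: to_fract_def eq_fract)
  define k where "k w = (case w of [] \<Rightarrow> - (p + \<iota> c * q) | x # _ \<Rightarrow> q * \<iota> (z x))" for w
  have "(\<Sum>w\<in>(\<lambda>x. [x]) ` F \<union> {[]}. k w * S w) = k [] * S [] + (\<Sum>x\<in>F. k [x] * S [x])"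
    using A by (subst sum.union_disjoint) (auto simp: sum.reindex inj_on_def)
  also have "\<dots> = - (p + \<iota> c * q) + q * s"
    by (simp add: k_def S1 s_def sum_distrib_left mult.assoc)
  also have "\<dots> = 0" using rel by (simp add: algebra_simps)
  finally have "k [x] = 0"
  proof (intro lin_indepD[OF indep ring(1), of "(\<lambda>x. [x]) ` F \<union> {[]}" k "[x]"])
    show "k w \<in> C" for w
      by (cases w; simp only: k_def list.case; intro ring) (use C(2) pq in auto)
  qed (use A x in auto)
  then show "z x = 0" using pq by (simp add: k_def complex_algebra_eq_0_iff[OF alg])
qed

text \<open>The constants of \<open>Frac C\<close> are those of \<open>\<complex>\<close>, as needed for the descent on relations.\<close>

lemma lin_indep_if_no_primitive:
  fixes \<iota> :: "complex \<Rightarrow> 'a::idom" and S :: "('x, 'a) series"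
  assumes alg: "complex_algebra \<iota>" and der: "derivation \<delta>"
    and C: "differential_subring \<delta> C" and u: "\<And>x. u x \<in> C"
    and sol: "solution \<delta> (letter_series u) S" and nnc: "no_new_constants \<iota> \<delta> C"
    and free: "no_primitive \<iota> \<delta> C u"
  shows "lin_indep C UNIV S"
  unfolding lin_indep_alt[OF subring_0[OF C]]
proof (intro allI impI ballI)
  fix F c w
  assume A: "finite F \<and> F \<subseteq> UNIV \<and> (\<forall>w\<in>F. c w \<in> C) \<and> (\<Sum>w\<in>F. c w * S w) = 0" and w: "w \<in> F"
  define P where "P w = to_fract (if w \<in> F then c w else 0)" for w
  have sub: "{w. P w \<noteq> 0} \<subseteq> F" by (auto simp: P_def split: if_splits)
  have "P w = 0"
  proof (rule relation_trivial[OF alg der C u sol])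
    show "\<exists>z. g = to_fract (\<iota> z)" if "g \<in> Frac C" "fract_deriv \<delta> g = 0" for g
      using nnc that unfolding no_new_constants_def Frac_def by blast
    show "z x = 0" if "g \<in> Frac C" "finite F" "(\<Sum>x\<in>F. to_fract (\<iota> (z x) * u x)) = fract_deriv \<delta> g"
        "x \<in> F" for g F z x
      using free that unfolding no_primitive_def by blast
    show "finite {w. P w \<noteq> 0}" using sub A finite_subset by blast
    show "P w \<in> Frac C" for w
      unfolding P_def by (rule Frac_to_fract[OF C]) (use A subring_0[OF C] in auto)
    have "relation_value S P = (\<Sum>w\<in>F. P w * to_fract (S w))"
      using A by (intro relation_value_superset[OF _ sub]) simp
    also have "\<dots> = to_fract (\<Sum>w\<in>F. c w * S w)"
      by (simp add: P_def)
    finally show "relation_value S P = 0" using A by (simp only: to_fract_0)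
  qed
  then show "c w = 0" using w by (simp add: P_def)
qed

section \<open>Independence of the coefficients of a grouplike solution\<close>

theorem theorem4p4:
  fixes \<iota> :: "complex \<Rightarrow> 'a::idom"
    and \<delta> :: "'a \<Rightarrow> 'a"
    and C\<^sub>0 :: "'a set"
    and u :: "'x::linorder \<Rightarrow> 'a"
    and S :: "('x, 'a) series"
  assumes alg: "complex_algebra \<iota>"
    and der: "derivation \<delta>"
    and ker: "{a. \<delta> a = 0} = range \<iota>"
    and C0: "differential_subring \<delta> C\<^sub>0" "range \<iota> \<subseteq> C\<^sub>0"
    and coeffs: "\<And>x. u x \<in> C\<^sub>0"
    and sol: "grouplike S" "solution \<delta> (letter_series u) S"
    and form1: "series_sums (\<lambda>w. smult_series (S w) (word w)) {w. w \<noteq> []} (\<lambda>w. S w - word [] w)"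
    and form2: "series_sums (\<lambda>w. smult_series (pairing S (baseS \<iota> w)) (baseP w)) {w. w \<noteq> []}
                  (\<lambda>w. S w - word [] w)"
    and form3: "decreasing_prod
                  (\<lambda>l. exp_series \<iota> (smult_series (pairing S (baseS \<iota> l)) (baseP l)))
                  {l. lyndon l} S"
  shows
    "((\<forall>H. grouplike H \<and> solution \<delta> (letter_series u) H \<longrightarrow>
         (\<exists>C\<in>lie_series. S = conc H (exp_series \<iota> C))) \<and>
      (\<forall>H. \<forall>C\<in>lie_series. S = conc H (exp_series \<iota> C) \<longrightarrow>
         grouplike H \<and> (solution \<delta> (letter_series u) H \<longleftrightarrow> deriv_series \<delta> C = (\<lambda>_. 0))))
     \<and>
     (let
         a = lin_indep C\<^sub>0 UNIV S;
         b = alg_indep C\<^sub>0 {l. lyndon l} S;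
         c = alg_indep C\<^sub>0 UNIV (\<lambda>x. S [x]);
         d = lin_indep C\<^sub>0 (range (\<lambda>x. [x]) \<union> {[]}) S;
         e = (\<forall>g\<in>Frac C\<^sub>0. \<forall>k :: 'x \<Rightarrow>\<^sub>0 complex.
                (\<Sum>x\<in>Poly_Mapping.keys k. to_fract (\<iota> (Poly_Mapping.lookup k x) * u x)) = fract_deriv \<delta> g \<longrightarrow>
                (\<forall>x. Poly_Mapping.lookup k x = 0));
         f = (lin_indep (range \<iota>) UNIV u \<and>
              fract_deriv \<delta> ` Frac C\<^sub>0 \<inter>
                to_fract ` module.span (\<lambda>z v. \<iota> z * v) (range u) = {0})
       in (a \<longleftrightarrow> b) \<and> (b \<longrightarrow> c) \<and> (c \<longrightarrow> d) \<and> (e \<longleftrightarrow> f) \<and>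
          (no_new_constants \<iota> \<delta> C\<^sub>0 \<longrightarrow>
             (a \<longleftrightarrow> b) \<and> (b \<longleftrightarrow> c) \<and> (c \<longleftrightarrow> d) \<and> (d \<longleftrightarrow> e) \<and> (e \<longleftrightarrow> f)))"
proof -
  have const: "\<delta> (\<iota> z) = 0" for z using ker by blast
  have S1: "S [] = 1" using sol(1) by (rule grouplike_Nil)
  have 0: "0 \<in> C\<^sub>0" by (rule subring_0[OF C0(1)])
  have "\<exists>C\<in>lie_series. S = conc H (exp_series \<iota> C)" if "grouplike H" for H
    using grouplike_quotient_exp_lie[OF alg sol(1) that] by blast
  moreover have "grouplike H" if "C \<in> lie_series" "S = conc H (exp_series \<iota> C)" for H C
    using that sol(1) grouplike_exp_series[OF alg lie_series_primitive]
    by (intro grouplike_quotient_right[of H "exp_series \<iota> C"]) auto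
  moreover have "solution \<delta> (letter_series u) H \<longleftrightarrow> deriv_series \<delta> C = (\<lambda>_. 0)"
    if "C \<in> lie_series" "S = conc H (exp_series \<iota> C)" for H C
    by (rule solution_iff_constant[of \<iota> \<delta> "letter_series u" S C H, OF alg der const sol(2) that])
  moreover have "lin_indep C\<^sub>0 UNIV S \<longleftrightarrow> alg_indep C\<^sub>0 {l. lyndon l} S"
    by (rule lin_indep_iff_alg_indep_lyndon[OF alg C0 sol(1)])
  moreover have "alg_indep C\<^sub>0 {l. lyndon l} S \<longrightarrow> alg_indep C\<^sub>0 UNIV (\<lambda>x. S [x])"
    using alg_indep_letters[OF 0] by blast
  moreover have "alg_indep C\<^sub>0 UNIV (\<lambda>x. S [x]) \<longrightarrow> lin_indep C\<^sub>0 (range (\<lambda>x. [x]) \<union> {[]}) S"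
    using lin_indep_letters[of C\<^sub>0 S, OF 0 S1] by blast
  moreover have "lin_indep C\<^sub>0 (range (\<lambda>x. [x]) \<union> {[]}) S \<longrightarrow> no_primitive \<iota> \<delta> C\<^sub>0 u"
    "no_primitive \<iota> \<delta> C\<^sub>0 u \<longrightarrow> lin_indep C\<^sub>0 UNIV S" if "no_new_constants \<iota> \<delta> C\<^sub>0"
    using no_primitive_if_lin_indep_letters[of \<iota> \<delta> C\<^sub>0 u S, OF alg der const C0 sol(2) that]
      lin_indep_if_no_primitive[of \<iota> \<delta> C\<^sub>0 u S, OF alg der C0(1) coeffs sol(2) that] by blast+
  ultimately show ?thesis
    unfolding Let_def no_primitive_conv_poly_mapping[OF alg, symmetric]
      no_primitive_conv_span[OF alg der C0(1), symmetric]
    by blast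
qed

end
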